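(* Let $\mathfrak g$ be of type $A_{2n}^{(2)}$ ($n\ge1$) or $D_{n+1}^{(2)}$ ($n\ge2$), and let $\Lambda$ be a dominant integral weight of level $1$. Then $$\Sigma^\Lambda_\Lambda(q)=\frac{1}{(q)_\infty\,(q^{\epsilon})_\infty^{\,n}} .$$
   Context: $\mathfrak g$ is of affine type $A_{2n}^{(2)}$ or $D_{n+1}^{(2)}$, with index set $\{0,\dots,n\}$, simple roots $\alpha_i$, fundamental weights $\Lambda_i$, and null root $\delta=2\alpha_0+\cdots+2\alpha_{n-1}+\alpha_n$ for $A_{2n}^{(2)}$, $\delta=\alpha_0+\cdots+\alpha_n$ for $D_{n+1}^{(2)}$. The level 1 weights are $\Lambda=\Lambda_0$ for $A_{2n}^{(2)}$ and $\Lambda\in\{\Lambda_0,\Lambda_n\}$ for $D_{n+1}^{(2)}$. Put $\ell=L=2n+1$, $\epsilon=1$ for $A_{2n}^{(2)}$; $\ell=n+1$, $L=2n+2$, $\epsilon=2$ for $D_{n+1}^{(2)}$. **Proper Young walls.** There are infinitely many columns, numbered $1,2,\dots$ from right to left. The blocks of color $0$ (and of color $n$ for $D_{n+1}^{(2)}$) have unit width and thickness and height $\tfrac12$; all other blocks are unit cubes. The ground state wall $Y_\Lambda$ has exactly one half-height block in each column, of color $0$ if $\Lambda=\Lambda_0$ and $n$ if $\Lambda=\Lambda_n$. On each column of $Y_\Lambda$ blocks are stacked in the following order, repeated periodically with period $L$: $0,1,\dots,n-1,n,n-1,\dots,1,0$ for $A_{2n}^{(2)}$; $0,1,\dots,n-1,n,n,n-1,\dots,1,0$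 for $D_{n+1}^{(2)}$, $\Lambda=\Lambda_0$; $n,n-1,\dots,1,0,0,1,\dots,n-1,n$ for $D_{n+1}^{(2)}$, $\Lambda=\Lambda_n$. A Young wall $Y=(y_k)_{k\ge1}$ is obtained by adding finitely many blocks so that the column heights weakly decrease in $k$; $|y_k|$ is the number of blocks added in column $k$. A column is full if its height (ground block included) is an integer, equivalently $\ell\nmid|y_k|$. $Y$ is proper if no two full columns have the same height. Thus a proper Young wall is the same thing as a partition $(|y_k|)_{k\ge1}$ whose parts not divisible by $\ell$ are pairwise distinct. $\mathcal Z(\Lambda)$ is the set of proper Young walls; $\mathrm{wt}(Y)=\Lambda-\sum_ik_i\alpha_i$ with $k_i$ the number of added $i$-blocks, and $\mathcal Z(\Lambda)_\lambda=\{Y\in\mathcal Z(\Lambda):\mathrm{wt}(Y)=\lambda\}$. The string function (of the Fock space representation with crystal $\mathcal Z(\Lambda)$) is $\Sigma^\Lambda_\lambda(q)=\sum_{m\ge0}|\mathcal Z(\Lambda)_{\lambda-m\delta}|\,q^m$. $(q)_\infty=\prod_{m\ge1}(1-q^m)$ and $(q^a)_\infty=\prod_{m\ge1}(1-q^{am})$. *)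

theory Defs
  imports "HOL-Analysis.Infinite_Products" "HOL-Computational_Algebra.Formal_Power_Series"
begin

text \<open>\<open>TwA\<close> with rank parameter \<open>n\<close> stands for the affine type \<open>A_{2n}^{(2)}\<close> and \<open>TwD\<close>
  for \<open>D_{n+1}^{(2)}\<close>; in both cases the index set is \<open>{0..n}\<close>.\<close>

datatype affine_type = TwA | TwD

fun admissible_rank :: "affine_type \<Rightarrow> nat \<Rightarrow> bool" where
  "admissible_rank TwA n \<longleftrightarrow> n \<ge> 1"
| "admissible_rank TwD n \<longleftrightarrow> n \<ge> 2"


section \<open>Weights\<close>

text \<open>The entry \<open>cartan X n i j\<close> is \<open>\<alpha>_j(h_i)\<close>. The numbering is the one for which the null root is
  \<open>2\<alpha>_0 + \<dots> + 2\<alpha>_{n-1} + \<alpha>_n\<close> (type \<open>A_{2n}^{(2)}\<close>) or \<open>\<alpha>_0 + \<dots> + \<alpha>_n\<close>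
  (type \<open>D_{n+1}^{(2)}\<close>).\<close>

definition cartan :: "affine_type \<Rightarrow> nat \<Rightarrow> nat \<Rightarrow> nat \<Rightarrow> int" where
  "cartan X n i j =
    (if i = j then 2
     else if j \<noteq> i + 1 \<and> i \<noteq> j + 1 then 0
     else case X of
       TwA \<Rightarrow> if n = 1 then (if i = 0 then - 4 else - 1)
              else if (i = 0 \<and> j = 1) \<or> (i = n - 1 \<and> j = n) then - 2 else - 1
     | TwD \<Rightarrow> if (i = 0 \<and> j = 1) \<or> (i = n \<and> j = n - 1) then - 2 else - 1)"

text \<open>An integral weight is a \<open>\<int>\<close>-valued linear form on the dual weight lattice spanned by the simple
  coroots \<open>h_0, \<dots>, h_n\<close> and the scaling element \<open>d\<close>. It is represented by its values on this
  basis, and by \<open>0\<close> at the superfluous indices \<open>i > n\<close>.\<close>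

datatype coweight = Coroot nat | Scaling

type_synonym weight = "coweight \<Rightarrow> int"

definition fund_weight :: "nat \<Rightarrow> weight" where
  "fund_weight i = (\<lambda>h. case h of Coroot j \<Rightarrow> (if j = i then 1 else 0) | Scaling \<Rightarrow> 0)"

definition simple_root :: "affine_type \<Rightarrow> nat \<Rightarrow> nat \<Rightarrow> weight" where
  "simple_root X n j =
    (\<lambda>h. case h of
       Coroot i \<Rightarrow> (if i \<le> n then cartan X n i j else 0)
     | Scaling \<Rightarrow> (if j = 0 then 1 else 0))"

definition null_root :: "affine_type \<Rightarrow> nat \<Rightarrow> weight" where
  "null_root X n =
    (\<lambda>h. \<Sum>i\<le>n. (case X of TwA \<Rightarrow> if i = n then 1 else 2 | TwD \<Rightarrow> 1) * simple_root X n i h)"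

definition dominant_integral :: "nat \<Rightarrow> weight \<Rightarrow> bool" where
  "dominant_integral n \<Lambda> \<longleftrightarrow> (\<forall>i\<le>n. 0 \<le> \<Lambda> (Coroot i)) \<and> (\<forall>i>n. \<Lambda> (Coroot i) = 0)"

text \<open>The coefficients of the simple coroots in the canonical central element.\<close>

definition comark :: "affine_type \<Rightarrow> nat \<Rightarrow> nat \<Rightarrow> int" where
  "comark X n i = (case X of TwA \<Rightarrow> if i = 0 then 1 else 2
                           | TwD \<Rightarrow> if i = 0 \<or> i = n then 1 else 2)"

definition level :: "affine_type \<Rightarrow> nat \<Rightarrow> weight \<Rightarrow> int" where
  "level X n \<Lambda> = (\<Sum>i\<le>n. comark X n i * \<Lambda> (Coroot i))"

text \<open>Dominant integral weights are taken modulo the null root, the representative being the one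
  that vanishes on \<open>d\<close>.\<close>

definition level_one_weights :: "affine_type \<Rightarrow> nat \<Rightarrow> weight set" where
  "level_one_weights X n = {\<Lambda>. dominant_integral n \<Lambda> \<and> level X n \<Lambda> = 1 \<and> \<Lambda> Scaling = 0}"

lemma level_one_weights_eq:
  assumes "admissible_rank X n"
  shows "level_one_weights X n =
    (case X of TwA \<Rightarrow> {fund_weight 0} | TwD \<Rightarrow> {fund_weight 0, fund_weight n})"
proof -
  let ?S = "{i. i \<le> n \<and> comark X n i = 1}"
  have S: "?S = (case X of TwA \<Rightarrow> {0} | TwD \<Rightarrow> {0, n})"
    by (auto simp: comark_def split: affine_type.splits if_splits)
  have pos: "comark X n i \<ge> 1" for i
    by (auto simp: comark_def split: affine_type.splits)
  have "level_one_weights X n = fund_weight ` ?S"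
  proof (intro equalityI subsetI)
    fix \<Lambda> assume "\<Lambda> \<in> level_one_weights X n"
    then have nn: "\<And>i. i \<le> n \<Longrightarrow> 0 \<le> \<Lambda> (Coroot i)" and z: "\<And>i. i > n \<Longrightarrow> \<Lambda> (Coroot i) = 0"
      and lev: "(\<Sum>i\<le>n. comark X n i * \<Lambda> (Coroot i)) = 1" and d: "\<Lambda> Scaling = 0"
      by (auto simp: level_one_weights_def dominant_integral_def level_def)
    define f where "f i = nat (comark X n i * \<Lambda> (Coroot i))" for i
    have f: "int (f i) = comark X n i * \<Lambda> (Coroot i)" if "i \<le> n" for i
      using nn[OF that] pos[of i] by (simp add: f_def)
    have "int (\<Sum>i\<le>n. f i) = 1"
      using lev f by simp
    then have "sum f {..n} = 1" by linarith
    then obtain i where i: "i \<le> n" "f i = 1" "\<And>j. j \<le> n \<Longrightarrow> j \<noteq> i \<Longrightarrow> f j = 0"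
      using sum_eq_1_iff[of "{..n}" f] by (metis atMost_iff finite_atMost)
    have 1: "comark X n i * \<Lambda> (Coroot i) = 1" using f[of i] i by simp
    then have ci: "comark X n i = 1" and li: "\<Lambda> (Coroot i) = 1"
      using pos[of i] by (auto simp: zmult_eq_1_iff)
    have "\<Lambda> (Coroot j) = 0" if "j \<noteq> i" for j
    proof (cases "j \<le> n")
      case True
      then have "comark X n j * \<Lambda> (Coroot j) = 0" using f[of j] i(3)[of j] that by simp
      then show ?thesis using pos[of j] by auto
    qed (use z in simp)
    then have "\<Lambda> = fund_weight i"
      using li d by (auto simp: fund_weight_def fun_eq_iff split: coweight.splits)
    then show "\<Lambda> \<in> fund_weight ` ?S" using i ci by auto
  next
    fix \<Lambda> assume "\<Lambda> \<in> fund_weight ` ?S"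
    then obtain i where "i \<le> n" "comark X n i = 1" "\<Lambda> = fund_weight i" by auto
    then show "\<Lambda> \<in> level_one_weights X n"
      by (auto simp: level_one_weights_def dominant_integral_def level_def fund_weight_def
          if_distrib cong: if_cong)
  qed
  then show ?thesis unfolding S by (cases X) auto
qed


section \<open>Proper Young walls\<close>

definition ground_color :: "nat \<Rightarrow> weight \<Rightarrow> nat" where
  "ground_color n \<Lambda> = (if \<Lambda> = fund_weight 0 then 0 else n)"

text \<open>One period of the colors of the blocks stacked, from bottom to top, on the ground block.\<close>

definition stacking_pattern :: "affine_type \<Rightarrow> nat \<Rightarrow> weight \<Rightarrow> nat list" where
  "stacking_pattern X n \<Lambda> =
    (case X of
       TwA \<Rightarrow> [0..<n + 1] @ rev [0..<n]
     | TwD \<Rightarrow> if ground_color n \<Lambda> = 0 then [0..<n + 1] @ rev [0..<n + 1]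
              else rev [0..<n + 1] @ [0..<n + 1])"

definition block_color :: "affine_type \<Rightarrow> nat \<Rightarrow> weight \<Rightarrow> nat \<Rightarrow> nat" where
  "block_color X n \<Lambda> j =
    stacking_pattern X n \<Lambda> ! (j mod length (stacking_pattern X n \<Lambda>))"

definition block_height :: "affine_type \<Rightarrow> nat \<Rightarrow> nat \<Rightarrow> rat" where
  "block_height X n i = (if i = 0 \<or> (X = TwD \<and> i = n) then 1 / 2 else 1)"

text \<open>A wall is given by the number \<open>Y k\<close> of blocks added to its \<open>k\<close>-th column from the right. Columns
  and the added blocks of a column are counted from \<open>0\<close>.\<close>

type_synonym wall = "nat \<Rightarrow> nat"

definition column_height :: "affine_type \<Rightarrow> nat \<Rightarrow> weight \<Rightarrow> wall \<Rightarrow> nat \<Rightarrow> rat" where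
  "column_height X n \<Lambda> Y k =
    block_height X n (ground_color n \<Lambda>) + (\<Sum>j<Y k. block_height X n (block_color X n \<Lambda> j))"

definition young_wall :: "affine_type \<Rightarrow> nat \<Rightarrow> weight \<Rightarrow> wall \<Rightarrow> bool" where
  "young_wall X n \<Lambda> Y \<longleftrightarrow> finite {k. Y k \<noteq> 0} \<and> antimono (column_height X n \<Lambda> Y)"

definition full_column :: "affine_type \<Rightarrow> nat \<Rightarrow> weight \<Rightarrow> wall \<Rightarrow> nat \<Rightarrow> bool" where
  "full_column X n \<Lambda> Y k \<longleftrightarrow> column_height X n \<Lambda> Y k \<in> \<int>"

definition proper_young_walls :: "affine_type \<Rightarrow> nat \<Rightarrow> weight \<Rightarrow> wall set" where
  "proper_young_walls X n \<Lambda> =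
    {Y. young_wall X n \<Lambda> Y \<and>
        (\<forall>k k'. k \<noteq> k' \<and> full_column X n \<Lambda> Y k \<and> full_column X n \<Lambda> Y k' \<longrightarrow>
           column_height X n \<Lambda> Y k \<noteq> column_height X n \<Lambda> Y k')}"

definition num_blocks :: "affine_type \<Rightarrow> nat \<Rightarrow> weight \<Rightarrow> wall \<Rightarrow> nat \<Rightarrow> nat" where
  "num_blocks X n \<Lambda> Y i = card {(k, j). j < Y k \<and> block_color X n \<Lambda> j = i}"

definition wall_weight :: "affine_type \<Rightarrow> nat \<Rightarrow> weight \<Rightarrow> wall \<Rightarrow> weight" where
  "wall_weight X n \<Lambda> Y =
    (\<lambda>h. \<Lambda> h - (\<Sum>i\<le>n. int (num_blocks X n \<Lambda> Y i) * simple_root X n i h))"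

definition walls_of_weight :: "affine_type \<Rightarrow> nat \<Rightarrow> weight \<Rightarrow> weight \<Rightarrow> wall set" where
  "walls_of_weight X n \<Lambda> \<mu> = {Y \<in> proper_young_walls X n \<Lambda>. wall_weight X n \<Lambda> Y = \<mu>}"


section \<open>String functions\<close>

text \<open>Identities in \<open>q\<close> are identities of formal power series, \<open>q\<close> being \<^const>\<open>fps_X\<close>, and infinite
  products converge in the \<open>q\<close>-adic topology of the library.\<close>

definition string_function :: "affine_type \<Rightarrow> nat \<Rightarrow> weight \<Rightarrow> weight \<Rightarrow> rat fps" where
  "string_function X n \<Lambda> \<mu> =
    Abs_fps (\<lambda>m. of_nat (card (walls_of_weight X n \<Lambda> (\<lambda>h. \<mu> h - int m * null_root X n h))))"

text \<open>\<open>qpoch_inf a\<close> is \<open>(q^a)\<^sub>\<infinity>\<close>.\<close>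

definition qpoch_inf :: "nat \<Rightarrow> rat fps" where
  "qpoch_inf a = prodinf (\<lambda>m. 1 - fps_X ^ (a * Suc m))"

definition eps :: "affine_type \<Rightarrow> nat" where
  "eps X = (case X of TwA \<Rightarrow> 1 | TwD \<Rightarrow> 2)"

end

theory Submission
  imports Defs "HOL-Library.Multiset"
begin

text \<open>Since the simple roots are linearly independent, a wall has weight \<open>\<Lambda> - m\<delta>\<close> exactly when its numbers
  of blocks of the various colors are \<open>m\<close> times the coefficients of \<open>\<delta>\<close>. A wall is a partition, that
  is a multiset of positive part sizes, so the task is to count the partitions with this content.

  Let \<open>l = 2n + 1\<close>, respectively \<open>n + 1\<close>, be the number of blocks in \<open>\<delta>\<close>, and let \<open>L = \<epsilon>l\<close> be the period of
  the stacking pattern. The pattern is a palindrome. Hence a part \<open>r \<equiv> s (mod L)\<close> and a part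
  \<open>r' \<equiv> -s (mod L)\<close> have opposite contents modulo \<open>\<delta>\<close>, parts divisible by \<open>l\<close> have a multiple of \<open>\<delta>\<close> as
  content, and for \<open>1 \<le> s \<le> n\<close> the contents of the first \<open>s\<close> blocks are linearly independent modulo
  \<open>\<delta>\<close>. So the content is a multiple of \<open>\<delta>\<close> exactly when, for each such \<open>s\<close>, there are as many parts
  \<open>\<equiv> s\<close> as parts \<open>\<equiv> -s\<close>, and then the multiple is the size of the partition divided by \<open>l\<close>
  (\<open>content_iff\<close>).

  The partitions in question therefore split into independent components. The parts divisible by \<open>l\<close>
  form an arbitrary partition and contribute \<open>1 / (q)\<^sub>\<infinity>\<close>. For each \<open>s \<in> {1..n}\<close> the parts \<open>aL + s\<close> and
  \<open>(b + 1)L - s\<close> are given by finite sets \<open>A\<close> of numbers \<open>a\<close> and \<open>B\<close> of numbers \<open>b\<close> of the same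
  cardinality; they contribute \<open>q\<close> to the power \<open>\<epsilon>(\<Sum>a + \<Sum>(b + 1))\<close>. The generating function of such
  pairs is the constant term in \<open>z\<close> of \<open>\<Prod>(1 + zq\<^bsup>\<epsilon>a\<^esup>)(1 + z\<^bsup>-1\<^esup>q\<^bsup>\<epsilon>(a+1)\<^esup>)\<close>, which is \<open>1 / (q\<^sup>\<epsilon>)\<^sub>\<infinity>\<close> by the Jacobi
  triple product. Here this constant term is computed in \<open>balanced_pairs_gf\<close> from its
  finite form: pairs inside a window of length \<open>N\<close> are the \<open>N\<close>-element subsets of a set of size \<open>2N\<close>,
  which the \<open>q\<close>-binomial theorem enumerates, and \<open>N\<close> tends to infinity. Adding the residues \<open>s\<close> one by
  one gives \<open>layer_gf\<close>, which is the theorem once walls have been translated into multisets.\<close>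

section \<open>Limits of formal power series\<close>

lemma fps_tendsto_mult:
  fixes f g :: "'b \<Rightarrow> 'a::ring_1 fps"
  assumes "(f \<longlongrightarrow> a) F" and "(g \<longlongrightarrow> b) F"
  shows "((\<lambda>x. f x * g x) \<longlongrightarrow> a * b) F"
proof (rule tendsto_fpsI)
  fix m
  have "\<forall>\<^sub>F x in F. \<forall>i\<in>{..m}. fps_nth (f x) i = fps_nth a i"
    using assms(1) by (intro eventually_ball_finite) (auto simp: tendsto_fps_iff)
  moreover have "\<forall>\<^sub>F x in F. \<forall>i\<in>{..m}. fps_nth (g x) i = fps_nth b i"
    using assms(2) by (intro eventually_ball_finite) (auto simp: tendsto_fps_iff)
  ultimately show "\<forall>\<^sub>F x in F. fps_nth (f x * g x) m = fps_nth (a * b) m"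
    by eventually_elim (simp add: fps_mult_nth)
qed

text \<open>The finite \<open>q\<close>-Pochhammer symbol \<open>(q; q)\<^sub>N\<close>.\<close>

definition qpoch :: "'a::comm_ring_1 \<Rightarrow> nat \<Rightarrow> 'a" where
  "qpoch q N = (\<Prod>m<N. 1 - q ^ Suc m)"

lemma qpoch_0 [simp]: "qpoch q 0 = 1"
  by (simp add: qpoch_def)

lemma qpoch_Suc: "qpoch q (Suc N) = qpoch q N * (1 - q ^ Suc N)"
  by (simp add: qpoch_def)

text \<open>The factor with index \<open>N\<close> changes only coefficients of degree at least \<open>a(N + 1)\<close>, so each
  coefficient of the partial products is eventually constant. The constant coefficient of the limit
  is \<open>1\<close>, whence the infinite product converges in the strict sense, to a nonzero value.\<close>

lemma qpoch_inf_limit: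
  assumes "a > 0"
  shows "(\<lambda>N. qpoch (fps_X ^ a) N) \<longlonglongrightarrow> qpoch_inf a" and "qpoch_inf a \<noteq> 0"
proof -
  define P :: "nat \<Rightarrow> rat fps" where "P N = qpoch (fps_X ^ a) N" for N
  define L where "L = Abs_fps (\<lambda>m. fps_nth (P m) m)"
  have step: "fps_nth (P (Suc N)) m = fps_nth (P N) m" if "m \<le> N" for N m
  proof -
    have "N < a * Suc N" using assms by (cases a) auto
    then have "m < a * Suc N" using that by linarith
    moreover have "P (Suc N) = P N - fps_X ^ (a * Suc N) * P N"
      by (simp add: P_def qpoch_Suc algebra_simps power_add flip: power_mult)
    ultimately show ?thesis
      by (simp only: fps_sub_nth fps_X_power_mult_nth) simp
  qed
  have stable: "fps_nth (P N) m = fps_nth L m" if "m \<le> N" for N m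
    using that by (induction N rule: dec_induct) (auto simp: step L_def)
  have lim: "P \<longlonglongrightarrow> L"
    using stable unfolding tendsto_fps_iff eventually_sequentially by blast
  have L0: "L \<noteq> 0"
  proof
    assume "L = 0"
    then have "fps_nth L 0 = 0" by simp
    then show False by (simp add: L_def P_def)
  qed
  have "raw_has_prod (\<lambda>m. 1 - fps_X ^ (a * Suc m)) 0 L"
  proof -
    have "(\<lambda>N. \<Prod>m\<le>N. 1 - (fps_X :: rat fps) ^ (a * Suc m)) = (\<lambda>N. P (Suc N))"
      by (simp add: P_def qpoch_def lessThan_Suc_atMost power_mult del: power_Suc mult_Suc_right)
    then show ?thesis
      using lim L0 by (simp add: raw_has_prod_def filterlim_sequentially_Suc del: mult_Suc_right)
  qed
  then have "(\<lambda>m. 1 - fps_X ^ (a * Suc m)) has_prod L"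
    by (simp add: has_prod_def)
  then have "L = qpoch_inf a"
    unfolding qpoch_inf_def by (rule has_prod_unique)
  then show "(\<lambda>N. qpoch (fps_X ^ a) N) \<longlonglongrightarrow> qpoch_inf a" and "qpoch_inf a \<noteq> 0"
    using lim L0 unfolding P_def[abs_def] by auto
qed

section \<open>Subsets of a given cardinality and the q-binomial theorem\<close>

text \<open>The Gaussian binomial coefficient \<open>[n, k]\<^sub>q\<close>, up to the factor \<open>q\<^bsup>k(k-1)/2\<^esup>\<close>: the subset
  \<open>{0..<k}\<close> has the smallest sum.\<close>

definition subset_gf :: "'a::comm_ring_1 \<Rightarrow> nat \<Rightarrow> nat \<Rightarrow> 'a" where
  "subset_gf q n k = (\<Sum>C | C \<subseteq> {..<n} \<and> card C = k. q ^ (\<Sum>C))"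

lemma subset_gf_0: "subset_gf q n 0 = 1"
proof -
  have "{C. C \<subseteq> {..<n} \<and> card C = 0} = {{}}"
    by (auto dest: finite_subset)
  then show ?thesis by (simp add: subset_gf_def)
qed

lemma subset_gf_eq_0:
  assumes "n < k"
  shows "subset_gf q n k = 0"
proof -
  have "card C \<le> n" if "C \<subseteq> {..<n}" for C
    using card_mono[OF finite_lessThan that] by simp
  then have "{C. C \<subseteq> {..<n} \<and> card C = k} = {}"
    using assms by (intro equals0I) (metis (mono_tags, lifting) linorder_not_less mem_Collect_eq)
  then show ?thesis unfolding subset_gf_def by (metis (no_types, lifting) sum.empty)
qed

lemma subset_gf_Suc:
  "subset_gf q (Suc n) (Suc k) = subset_gf q n (Suc k) + q ^ n * subset_gf q n k"
proof -
  let ?S = "\<lambda>n k. {C :: nat set. C \<subseteq> {..<n} \<and> card C = k}"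
  have fin: "finite (?S n k)" for n k
    by (rule finite_subset[of _ "Pow {..<n}"]) auto
  have split: "?S (Suc n) (Suc k) = ?S n (Suc k) \<union> insert n ` ?S n k"
  proof (intro equalityI subsetI)
    fix C assume C: "C \<in> ?S (Suc n) (Suc k)"
    then have f: "finite C" using finite_subset by blast
    show "C \<in> ?S n (Suc k) \<union> insert n ` ?S n k"
    proof (cases "n \<in> C")
      case True
      then have "C = insert n (C - {n})" "C - {n} \<in> ?S n k"
        using C f by (auto simp: less_Suc_eq)
      then show ?thesis by blast
    next
      case False
      then show ?thesis using C by (auto simp: less_Suc_eq)
    qed
  next
    fix C assume "C \<in> ?S n (Suc k) \<union> insert n ` ?S n k"
    then consider "C \<in> ?S n (Suc k)" | C' where "C = insert n C'" "C' \<in> ?S n k" by blast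
    then show "C \<in> ?S (Suc n) (Suc k)"
    proof cases
      case 1
      then show ?thesis by (auto simp: less_Suc_eq)
    next
      case 2
      then have "finite C'" "n \<notin> C'" using finite_subset by auto
      with 2 show ?thesis by (auto simp: less_Suc_eq)
    qed
  qed
  have inj: "inj_on (insert n) (?S n k)"
    by (rule inj_onI) (metis (mono_tags, lifting) insert_ident lessThan_iff less_irrefl mem_Collect_eq subsetD)
  have im: "(\<Sum>C\<in>insert n ` ?S n k. q ^ (\<Sum>C)) = (\<Sum>C\<in>?S n k. q ^ n * q ^ (\<Sum>C))"
    unfolding sum.reindex[OF inj] comp_def
  proof (rule sum.cong[OF refl])
    fix C assume "C \<in> ?S n k"
    then have "finite C" "n \<notin> C" using finite_subset by auto
    then show "q ^ \<Sum> (insert n C) = q ^ n * q ^ \<Sum> C" by (simp add: power_add)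
  qed
  have "?S n (Suc k) \<inter> insert n ` ?S n k = {}" by auto
  with im show ?thesis
    unfolding subset_gf_def split
    by (simp add: sum.union_disjoint fin finite_imageI sum_distrib_left)
qed

text \<open>The \<open>q\<close>-binomial theorem, cleared of denominators so that it holds in every commutative ring. It
  follows from the \<open>q\<close>-Pascal rule \<open>subset_gf_Suc\<close>, because
  \<open>(1 - q\<^bsup>n-j\<^esup>) + q\<^bsup>n-j\<^esup>(1 - q\<^bsup>j+1\<^esup>) = 1 - q\<^bsup>n+1\<^esup>\<close>.\<close>

lemma q_binomial:
  "k \<le> n \<Longrightarrow>
     subset_gf q n k * (qpoch q k * qpoch q (n - k)) = q ^ (\<Sum>{..<k}) * qpoch q n"
proof (induction n arbitrary: k)
  case 0
  then show ?case by (simp add: subset_gf_0)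
next
  case (Suc n k)
  show ?case
  proof (cases k)
    case 0
    then show ?thesis by (simp add: subset_gf_0)
  next
    case k: (Suc j)
    then have j: "j \<le> n" using Suc.prems by simp
    let ?P = "qpoch q (Suc j) * qpoch q (n - j)"
    have IH: "subset_gf q n j * (qpoch q j * qpoch q (n - j)) = q ^ (\<Sum>{..<j}) * qpoch q n"
      by (rule Suc.IH) fact
    have A: "subset_gf q n (Suc j) * ?P = (1 - q ^ (n - j)) * q ^ (\<Sum>{..<Suc j}) * qpoch q n"
    proof (cases "j = n")
      case True
      then show ?thesis by (simp add: subset_gf_eq_0)
    next
      case False
      then have e: "n - j = Suc (n - Suc j)" and l: "Suc j \<le> n" using j by auto
      have "subset_gf q n (Suc j) * ?P
          = subset_gf q n (Suc j) * (qpoch q (Suc j) * qpoch q (n - Suc j)) * (1 - q ^ (n - j))"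
        unfolding e qpoch_Suc[of q "n - Suc j"] by (simp only: mult_ac)
      also have "\<dots> = q ^ (\<Sum>{..<Suc j}) * qpoch q n * (1 - q ^ (n - j))"
        by (simp only: Suc.IH[OF l])
      finally show ?thesis by (simp only: mult_ac)
    qed
    have B: "q ^ n * subset_gf q n j * ?P
        = q ^ (n - j) * (1 - q ^ Suc j) * q ^ (\<Sum>{..<Suc j}) * qpoch q n"
    proof -
      have "q ^ n * subset_gf q n j * ?P
          = q ^ n * (1 - q ^ Suc j) * (subset_gf q n j * (qpoch q j * qpoch q (n - j)))"
        unfolding qpoch_Suc by (simp only: mult_ac)
      also have "\<dots> = q ^ (n - j) * q ^ j * (1 - q ^ Suc j) * (q ^ (\<Sum>{..<j}) * qpoch q n)"
        unfolding IH using j by (simp flip: power_add)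
      also have "\<dots> = q ^ (n - j) * (1 - q ^ Suc j) * (q ^ j * q ^ (\<Sum>{..<j})) * qpoch q n"
        by (simp only: mult_ac)
      also have "q ^ j * q ^ (\<Sum>{..<j}) = q ^ (\<Sum>{..<Suc j})"
        by (simp add: power_add)
      finally show ?thesis .
    qed
    have e: "Suc n = (n - j) + Suc j" using j by simp
    have "subset_gf q (Suc n) k * (qpoch q k * qpoch q (Suc n - k))
        = subset_gf q n (Suc j) * ?P + q ^ n * subset_gf q n j * ?P"
      unfolding k subset_gf_Suc by (simp add: algebra_simps)
    also have "\<dots> = q ^ (\<Sum>{..<k}) * (qpoch q n * (1 - q ^ (n - j) * q ^ Suc j))"
      unfolding A B k by (simp add: algebra_simps)
    also have "qpoch q n * (1 - q ^ (n - j) * q ^ Suc j) = qpoch q (Suc n)"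
      unfolding qpoch_Suc by (metis e power_add)
    finally show ?thesis .
  qed
qed


section \<open>Generating functions of weighted sets\<close>

text \<open>Meaningful only if each value of \<open>w\<close> is attained finitely often, as infinite sets have
  cardinality \<open>0\<close>.\<close>

definition gf :: "'a set \<Rightarrow> ('a \<Rightarrow> nat) \<Rightarrow> rat fps" where
  "gf S w = Abs_fps (\<lambda>m. of_nat (card {x \<in> S. w x = m}))"

lemma gf_bij:
  assumes "bij_betw f S T" and "\<And>x. x \<in> S \<Longrightarrow> v (f x) = w x"
  shows "gf S w = gf T v"
proof -
  have "bij_betw f {x \<in> S. w x = m} {y \<in> T. v y = m}" for m
    using assms unfolding bij_betw_def inj_on_def by auto
  then show ?thesis by (auto simp: gf_def fps_eq_iff dest: bij_betw_same_card)
qed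

lemma gf_times:
  assumes "\<And>m. finite {x \<in> S. w x = m}" and "\<And>m. finite {y \<in> T. v y = m}"
  shows "gf (S \<times> T) (\<lambda>(x, y). w x + v y) = gf S w * gf T v"
proof (rule fps_ext)
  fix m
  have "{p \<in> S \<times> T. (\<lambda>(x, y). w x + v y) p = m}
      = (\<Union>i\<in>{0..m}. {x \<in> S. w x = i} \<times> {y \<in> T. v y = m - i})"
    by auto
  then have "card {p \<in> S \<times> T. (\<lambda>(x, y). w x + v y) p = m}
      = (\<Sum>i=0..m. card {x \<in> S. w x = i} * card {y \<in> T. v y = m - i})"
    using assms by (simp only: card_cartesian_product[symmetric]) (rule card_UN_disjoint, auto)
  then show "fps_nth (gf (S \<times> T) (\<lambda>(x, y). w x + v y)) m = fps_nth (gf S w * gf T v) m"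
    by (simp add: gf_def fps_mult_nth)
qed

lemma gf_finite:
  assumes "finite S"
  shows "gf S w = (\<Sum>x\<in>S. fps_X ^ w x)"
proof (rule fps_ext)
  fix m
  have "{x \<in> S. m = w x} = {x \<in> S. w x = m}" by auto
  then show "fps_nth (gf S w) m = fps_nth (\<Sum>x\<in>S. fps_X ^ w x) m"
    using assms by (simp add: gf_def fps_sum_nth sum.If_cases Int_def)
qed

lemma gf_tendsto:
  assumes "\<And>N. T N \<subseteq> S" and "\<And>x N. x \<in> S \<Longrightarrow> w x \<le> N \<Longrightarrow> x \<in> T N"
  shows "(\<lambda>N. gf (T N) w) \<longlonglongrightarrow> gf S w"
proof (rule tendsto_fpsI)
  fix m
  have "fps_nth (gf (T N) w) m = fps_nth (gf S w) m" if "m \<le> N" for N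
  proof -
    have "{x \<in> T N. w x = m} = {x \<in> S. w x = m}" using that assms by blast
    then show ?thesis by (simp add: gf_def)
  qed
  then show "\<forall>\<^sub>F N in sequentially. fps_nth (gf (T N) w) m = fps_nth (gf S w) m"
    unfolding eventually_sequentially by blast
qed

section \<open>Partitions\<close>

lemma member_le_sum_mset: "x \<in># M \<Longrightarrow> x \<le> sum_mset M" for M :: "nat multiset"
  using sum_mset.remove[of x M] by simp

lemma finite_multisets_sum:
  "finite {M :: nat multiset. 0 \<notin># M \<and> sum_mset M = m}"
proof (rule finite_subset)
  show "finite (mset ` {xs. set xs \<subseteq> {..m} \<and> length xs \<le> m})"
    by (intro finite_imageI finite_lists_length_le) simp
  show "{M. 0 \<notin># M \<and> sum_mset M = m} \<subseteq> mset ` {xs. set xs \<subseteq> {..m} \<and> length xs \<le> m}"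
  proof
    fix M :: "nat multiset" assume M: "M \<in> {M. 0 \<notin># M \<and> sum_mset M = m}"
    obtain xs where xs: "mset xs = M" using ex_mset by blast
    have "size M \<le> sum_mset M"
    proof -
      have "0 \<notin># M" using M by simp
      then show ?thesis by (induction M) auto
    qed
    moreover have "x \<le> sum_mset M" if "x \<in># M" for x
      using that by (rule member_le_sum_mset)
    ultimately have "set xs \<subseteq> {..m} \<and> length xs \<le> m"
      using M xs by auto
    then show "M \<in> mset ` {xs. set xs \<subseteq> {..m} \<and> length xs \<le> m}"
      using xs by blast
  qed
qed

text \<open>Euler: if \<open>T\<^sub>N\<close> is the set of partitions with parts at most \<open>N\<close>, a member of \<open>T\<^sub>N\<^sub>+\<^sub>1\<close> either lies
  in \<open>T\<^sub>N\<close> or arises from a member of \<open>T\<^sub>N\<^sub>+\<^sub>1\<close> by adding a part \<open>N + 1\<close>. Thus passing from \<open>N\<close> to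
  \<open>N + 1\<close> divides the generating function by \<open>1 - q\<^bsup>N+1\<^esup>\<close>.\<close>

lemma partitions_gf:
  "gf {M. 0 \<notin># M} sum_mset * qpoch_inf 1 = 1"
proof -
  define T :: "nat \<Rightarrow> nat multiset set" where "T N = {M. set_mset M \<subseteq> {1..N}}" for N
  have fin: "finite {M \<in> T N. sum_mset M = m}" for N m
    by (rule finite_subset[OF _ finite_multisets_sum[of m]]) (auto simp: T_def)
  have step: "gf (T (Suc N)) sum_mset = gf (T N) sum_mset + fps_X ^ Suc N * gf (T (Suc N)) sum_mset"
    for N
  proof (rule fps_ext)
    fix m
    let ?A = "{M \<in> T N. sum_mset M = m}"
    let ?B = "{M \<in> T (Suc N). Suc N + sum_mset M = m}"
    have split: "{M \<in> T (Suc N). sum_mset M = m} = ?A \<union> add_mset (Suc N) ` ?B"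
    proof (intro equalityI subsetI)
      fix M assume M: "M \<in> {M \<in> T (Suc N). sum_mset M = m}"
      show "M \<in> ?A \<union> add_mset (Suc N) ` ?B"
      proof (cases "Suc N \<in># M")
        case True
        then obtain M' where "M = add_mset (Suc N) M'" by (metis multi_member_split)
        with M show ?thesis by (auto simp: T_def)
      next
        case False
        then have "set_mset M \<subseteq> {1..N}" using M by (auto simp: T_def subset_iff) (metis le_SucE)
        then show ?thesis using M by (auto simp: T_def)
      qed
    qed (auto simp: T_def subset_iff le_Suc_eq)
    have "finite ?B"
      by (rule finite_subset[OF _ fin[of "Suc N" "m - Suc N"]]) auto
    moreover have "?A \<inter> add_mset (Suc N) ` ?B = {}"
    proof -
      have "Suc N \<notin># M" if "M \<in> ?A" for M using that by (auto simp: T_def)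
      then show ?thesis by fastforce
    qed
    ultimately have "card {M \<in> T (Suc N). sum_mset M = m} = card ?A + card ?B"
      unfolding split using fin by (subst card_Un_disjoint) (auto simp: card_image inj_on_def)
    moreover have "?B = (if m < Suc N then {} else {M \<in> T (Suc N). sum_mset M = m - Suc N})"
      by auto
    ultimately show "fps_nth (gf (T (Suc N)) sum_mset) m
        = fps_nth (gf (T N) sum_mset + fps_X ^ Suc N * gf (T (Suc N)) sum_mset) m"
      unfolding fps_add_nth fps_X_power_mult_nth by (simp add: gf_def)
  qed
  have prod: "gf (T N) sum_mset * qpoch (fps_X ^ 1) N = 1" for N
  proof (induction N)
    case 0
    have "T 0 = {{#}}" by (auto simp: T_def)
    then show ?case by (simp add: gf_finite)
  next
    case (Suc N)
    have "gf (T (Suc N)) sum_mset * (1 - fps_X ^ Suc N) = gf (T N) sum_mset"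
      using step[of N] by (simp add: algebra_simps)
    then have "gf (T (Suc N)) sum_mset * qpoch (fps_X ^ 1) (Suc N)
        = gf (T N) sum_mset * qpoch (fps_X ^ 1) N"
      unfolding qpoch_Suc by (metis (no_types, lifting) mult.assoc mult.commute power_one_right)
    then show ?case using Suc by simp
  qed
  have "x \<le> sum_mset M" if "x \<in># M" for x and M :: "nat multiset"
    using that by (rule member_le_sum_mset)
  then have "(\<lambda>N. gf (T N) sum_mset) \<longlonglongrightarrow> gf {M. 0 \<notin># M} sum_mset"
    by (intro gf_tendsto) (auto simp: T_def subset_iff Suc_le_eq intro: Nat.gr0I order_trans)
  from fps_tendsto_mult[OF this qpoch_inf_limit(1)[of 1]]
  have "(\<lambda>N. 1) \<longlonglongrightarrow> gf {M. 0 \<notin># M} sum_mset * qpoch_inf 1"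
    by (simp only: prod zero_less_one simp_thms)
  then show ?thesis by (simp add: LIMSEQ_const_iff)
qed


section \<open>Pairs of equinumerous finite sets\<close>

definition balanced_pairs :: "(nat set \<times> nat set) set" where
  "balanced_pairs = {(A, B). finite A \<and> finite B \<and> card A = card B}"

text \<open>The shift in the second sum reflects that \<open>b \<in> B\<close> will stand for the part \<open>(b + 1)L - s\<close>, while
  \<open>a \<in> A\<close> stands for \<open>aL + s\<close>.\<close>

definition pair_weight :: "nat set \<times> nat set \<Rightarrow> nat" where
  "pair_weight = (\<lambda>(A, B). \<Sum>A + (\<Sum>b\<in>B. Suc b))"

text \<open>Think of \<open>N + a\<close> as the position \<open>a \<ge> 0\<close> and of \<open>N - 1 - b\<close> as the position \<open>-(b + 1) < 0\<close> of a
  row of \<open>2N\<close> sites. Starting from the state in which precisely the negative sites are occupied, \<open>A\<close>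
  lists the particles and \<open>B\<close> the holes; equinumerosity of \<open>A\<close> and \<open>B\<close> says that the number of
  occupied sites is still \<open>N\<close>, and the energy above that state is the weight of the pair.\<close>

lemma balanced_window_bij:
  fixes N :: nat
  defines "f \<equiv> (\<lambda>(A, B). (+) N ` A \<union> ({..<N} - (\<lambda>b. N - 1 - b) ` B))"
  shows "bij_betw f {(A, B) \<in> balanced_pairs. A \<subseteq> {..<N} \<and> B \<subseteq> {..<N}}
           {C. C \<subseteq> {..<N + N} \<and> card C = N}"
    and "\<And>p. p \<in> {(A, B) \<in> balanced_pairs. A \<subseteq> {..<N} \<and> B \<subseteq> {..<N}} \<Longrightarrow>
           \<Sum> (f p) = \<Sum> {..<N} + pair_weight p"
proof -
  let ?S = "{(A, B) \<in> balanced_pairs. A \<subseteq> {..<N} \<and> B \<subseteq> {..<N}}"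
  let ?T = "{C. C \<subseteq> {..<N + N} \<and> card C = N}"
  let ?r = "\<lambda>b. N - 1 - b"
  define g where "g C = ({a. N + a \<in> C}, {b. b < N \<and> ?r b \<notin> C})" for C
  have inj_r: "inj_on ?r {..<N}" by (auto simp: inj_on_def)
  have r_lt: "?r ` B \<subseteq> {..<N}" if "B \<subseteq> {..<N}" for B using that by auto
  have r_r: "?r (?r b) = b" if "b < N" for b using that by simp
  have disj: "(+) N ` A \<inter> ({..<N} - X) = {}" for A X by auto
  have card_f: "card (f (A, B)) = card A + (N - card B)"
    if "finite A" "B \<subseteq> {..<N}" for A B
  proof -
    have "card ({..<N} - ?r ` B) = N - card B"
      using that r_lt[OF that(2)] inj_r
      by (subst card_Diff_subset) (auto intro: finite_subset simp: card_image inj_on_subset)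
    then show ?thesis
      using that disj unfolding f_def by (simp add: card_Un_disjoint card_image)
  qed
  show "bij_betw f ?S ?T"
  proof (rule bij_betw_byWitness[where f' = g])
    show "\<forall>p\<in>?S. g (f p) = p"
    proof safe
      fix A B assume B: "B \<subseteq> {..<N}"
      have "b \<in> B \<longleftrightarrow> ?r b \<in> ?r ` B" if "b < N" for b
        using inj_on_image_mem_iff[OF inj_r, of b B] B that by simp
      then show "g (f (A, B)) = (A, B)"
        using B by (auto simp: g_def f_def)
    qed
    have fg: "f (g C) = C" for C
    proof (intro equalityI subsetI)
      fix x assume x: "x \<in> f (g C)"
      show "x \<in> C"
      proof (cases "x < N")
        case True
        then have "x \<notin> ?r ` {b. b < N \<and> ?r b \<notin> C}" using x by (auto simp: f_def g_def)
        moreover have "x = ?r (?r x)" "?r x < N" using True by auto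
        ultimately show ?thesis by (metis (mono_tags, lifting) imageI mem_Collect_eq)
      qed (use x in \<open>auto simp: f_def g_def\<close>)
    next
      fix x assume x: "x \<in> C"
      show "x \<in> f (g C)"
      proof (cases "x < N")
        case False
        then have "x = N + (x - N)" by simp
        then show ?thesis using x unfolding f_def g_def by (auto intro!: image_eqI[of x _ "x - N"])
      qed (use x in \<open>auto simp: f_def g_def\<close>)
    qed
    then show "\<forall>C\<in>?T. f (g C) = C" by blast
    show "f ` ?S \<subseteq> ?T"
    proof (intro image_subsetI)
      fix p assume "p \<in> ?S"
      then obtain A B where p: "p = (A, B)" and *: "(A, B) \<in> balanced_pairs"
        "A \<subseteq> {..<N}" "B \<subseteq> {..<N}" by blast
      have "f p \<subseteq> {..<N + N}" using * by (auto simp: f_def p)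
      moreover have "card B \<le> N" using card_mono[OF _ *(3)] by simp
      then have "card (f p) = N" using * card_f[of A B] by (auto simp: balanced_pairs_def p)
      ultimately show "f p \<in> ?T" by simp
    qed
    show "g ` ?T \<subseteq> ?S"
    proof (intro image_subsetI)
      fix C assume "C \<in> ?T"
      then have C: "C \<subseteq> {..<N + N}" "card C = N" by auto
      obtain A B where g: "g C = (A, B)" by fastforce
      have AN: "A \<subseteq> {..<N}" and BN: "B \<subseteq> {..<N}" using g C(1) by (auto simp: g_def)
      then have fin: "finite A" "finite B" by (auto intro: finite_subset)
      have "f (A, B) = C" using fg[of C] g by simp
      then have "card A + (N - card B) = N" using card_f[of A B] fin BN C by simp
      moreover have "card B \<le> N" using card_mono[OF _ BN] by simp
      ultimately have "card A = card B" by linarith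
      then show "g C \<in> ?S" using fin AN BN g by (simp add: balanced_pairs_def)
    qed
  qed
  fix p assume "p \<in> ?S"
  then obtain A B where p: "p = (A, B)" "finite A" "finite B" "card A = card B"
    "A \<subseteq> {..<N}" "B \<subseteq> {..<N}"
    by (auto simp: balanced_pairs_def)
  have 1: "\<Sum> ({..<N} - ?r ` B) + (\<Sum>b\<in>B. ?r b) = \<Sum> {..<N}"
    using sum.subset_diff[of "?r ` B" "{..<N}" id] r_lt[OF p(6)] inj_on_subset[OF inj_r p(6)]
    by (simp add: sum.reindex)
  have 2: "(\<Sum>b\<in>B. ?r b) + (\<Sum>b\<in>B. Suc b) = N * card B"
  proof -
    have "(\<Sum>b\<in>B. ?r b) + (\<Sum>b\<in>B. Suc b) = (\<Sum>b\<in>B. N)"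
      using p(6) unfolding sum.distrib[symmetric] by (intro sum.cong) auto
    then show ?thesis by simp
  qed
  have 3: "\<Sum> ((+) N ` A) = N * card A + \<Sum> A"
    by (simp add: sum.reindex sum.distrib)
  have "\<Sum> (f p) = \<Sum> ((+) N ` A) + \<Sum> ({..<N} - ?r ` B)"
    unfolding f_def p(1) using p disj by (simp add: sum.union_disjoint)
  then show "\<Sum> (f p) = \<Sum> {..<N} + pair_weight p"
    using 1 2 3 p(1,4) by (simp add: pair_weight_def)
qed

text \<open>A nonempty \<open>A\<close> forces \<open>B\<close> to be nonempty, and the shift then contributes at least \<open>1\<close> to the
  weight; this makes the bound on \<open>A\<close> strict.\<close>

lemma balanced_pairs_bounded:
  assumes p: "(A, B) \<in> balanced_pairs" and w: "pair_weight (A, B) \<le> N"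
  shows "A \<subseteq> {..<N}" and "B \<subseteq> {..<N}"
proof -
  have AB: "finite A" "finite B" "card A = card B"
    using p by (auto simp: balanced_pairs_def)
  have B: "b < N" if "b \<in> B" for b
    using member_le_sum[of b B Suc] that AB w by (simp add: pair_weight_def)
  have A: "a < N" if "a \<in> A" for a
  proof -
    have "card A \<noteq> 0" using that AB by auto
    then obtain b where "b \<in> B" using AB by (metis all_not_in_conv card.empty)
    then show ?thesis
      using member_le_sum[of b B Suc] member_le_sum[of a A id] that AB w
      by (simp add: pair_weight_def)
  qed
  show "A \<subseteq> {..<N}" and "B \<subseteq> {..<N}" using A B by auto
qed

lemma finite_balanced_pairs:
  assumes "e > 0"
  shows "finite {p \<in> balanced_pairs. e * pair_weight p = m}"
proof (rule finite_subset)
  have "pair_weight p \<le> m" if "e * pair_weight p = m" for p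
    using that assms by (cases e) auto
  then show "{p \<in> balanced_pairs. e * pair_weight p = m} \<subseteq> Pow {..<m} \<times> Pow {..<m}"
    using balanced_pairs_bounded by (auto; blast)
qed simp

text \<open>By the \<open>q\<close>-binomial theorem the pairs inside a window of length \<open>N\<close> have the generating function
  \<open>(q)\<^sub>2\<^sub>N / (q)\<^sub>N\<^sup>2\<close> in the variable \<open>q\<^sup>e\<close>, and this tends to \<open>1 / (q)\<^sub>\<infinity>\<close> in that variable.\<close>

lemma balanced_pairs_gf:
  assumes "e > 0"
  shows "gf balanced_pairs (\<lambda>p. e * pair_weight p) * qpoch_inf e = 1"
proof -
  let ?w = "\<lambda>p. e * pair_weight p"
  let ?q = "fps_X ^ e :: rat fps"
  define T where "T N = {(A, B) \<in> balanced_pairs. A \<subseteq> {..<N} \<and> B \<subseteq> {..<N}}" for N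
  have fin: "finite (T N)" for N
    by (rule finite_subset[of _ "Pow {..<N} \<times> Pow {..<N}"]) (auto simp: T_def)
  have prod: "gf (T N) ?w * (qpoch ?q N * qpoch ?q N) = qpoch ?q (N + N)" for N
  proof -
    have "subset_gf ?q (N + N) N = (\<Sum>p\<in>T N. ?q ^ (\<Sum>{..<N} + pair_weight p))"
      unfolding subset_gf_def T_def
      by (rule sum.reindex_bij_betw[OF balanced_window_bij(1), symmetric, THEN trans])
         (rule sum.cong[OF refl], simp only: balanced_window_bij(2))
    also have "\<dots> = ?q ^ (\<Sum>{..<N}) * gf (T N) ?w"
      using fin by (simp add: gf_finite sum_distrib_left power_add power_mult)
    finally have "?q ^ (\<Sum>{..<N}) * (gf (T N) ?w * (qpoch ?q N * qpoch ?q N))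
        = ?q ^ (\<Sum>{..<N}) * qpoch ?q (N + N)"
      using q_binomial[of N "N + N" ?q] by (simp add: mult.assoc)
    then show ?thesis by simp
  qed
  have "(\<lambda>N. gf (T N) ?w) \<longlonglongrightarrow> gf balanced_pairs ?w"
  proof (rule gf_tendsto)
    show "T N \<subseteq> balanced_pairs" for N by (auto simp: T_def)
    fix p N assume p: "p \<in> balanced_pairs" "e * pair_weight p \<le> N"
    have "pair_weight p \<le> N"
      using p(2) assms by (cases e) auto
    with p(1) show "p \<in> T N" by (cases p) (auto simp: T_def dest: balanced_pairs_bounded)
  qed
  moreover note P = qpoch_inf_limit(1)[OF assms]
  ultimately have "(\<lambda>N. gf (T N) ?w * (qpoch ?q N * qpoch ?q N))
      \<longlonglongrightarrow> gf balanced_pairs ?w * (qpoch_inf e * qpoch_inf e)"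
    by (intro fps_tendsto_mult)
  moreover have "(\<lambda>N. qpoch ?q (N + N)) \<longlonglongrightarrow> qpoch_inf e"
    by (rule filterlim_compose[OF P]) (rule filterlim_at_top_mono[OF filterlim_ident], simp)
  ultimately have "gf balanced_pairs ?w * (qpoch_inf e * qpoch_inf e) = qpoch_inf e"
    unfolding prod by (rule LIMSEQ_unique)
  then show ?thesis using qpoch_inf_limit(2)[OF assms] by (simp add: mult.assoc[symmetric])
qed


section \<open>Partitions with balanced residues\<close>

text \<open>The arithmetic shared by the two affine types: \<open>L\<close> is the period of the stacking pattern and a
  column is full unless its size is a multiple of \<open>l\<close>. In both cases the residues modulo \<open>L\<close> that are
  not divisible by \<open>l\<close> are the \<open>2n\<close> residues \<open>\<plusminus>1, \<dots>, \<plusminus>n\<close>.\<close>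

locale wall_period =
  fixes e n l L :: nat
  assumes L_eq: "L = e * l"
    and shape: "e = 1 \<and> l = 2 * n + 1 \<or> e = 2 \<and> l = n + 1"
begin

lemma period_bounds: "e > 0" "l > 0" "L > 0" "2 * n < L" "n < l"
  using shape by (auto simp: L_eq)

lemma dvd_period: "l dvd L"
  by (simp add: L_eq)

lemma dvd_iff_residue:
  "l dvd r \<longleftrightarrow> (\<forall>s\<in>{1..n}. r mod L \<noteq> s \<and> r mod L \<noteq> L - s)"
proof -
  define p where "p = r mod L"
  have "p < L" using period_bounds by (simp add: p_def)
  have "l dvd r \<longleftrightarrow> l dvd p"
    unfolding p_def using dvd_mod_iff[OF dvd_period] by simp
  also have "\<dots> \<longleftrightarrow> (\<forall>s\<in>{1..n}. p \<noteq> s \<and> p \<noteq> L - s)"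
  proof
    assume "l dvd p"
    show "\<forall>s\<in>{1..n}. p \<noteq> s \<and> p \<noteq> L - s"
    proof (intro ballI conjI notI)
      fix s assume s: "s \<in> {1..n}"
      then have "\<not> l dvd s" using period_bounds nat_dvd_not_less by auto
      then show "p = s \<Longrightarrow> False" using \<open>l dvd p\<close> by simp
      have "s \<le> L" using s period_bounds by auto
      then have "\<not> l dvd L - s" using \<open>\<not> l dvd s\<close> dvd_period dvd_diffD1 by blast
      then show "p = L - s \<Longrightarrow> False" using \<open>l dvd p\<close> by simp
    qed
  next
    assume *: "\<forall>s\<in>{1..n}. p \<noteq> s \<and> p \<noteq> L - s"
    have 1: "p = 0 \<or> p > n" using *[rule_format, of p] by force
    have 2: "p = 0 \<or> p < L - n"
    proof (rule ccontr)
      assume "\<not> ?thesis"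
      then have "L - p \<in> {1..n}" "p = L - (L - p)" using \<open>p < L\<close> by auto
      then show False using * by blast
    qed
    show "l dvd p"
    proof (cases "p = 0")
      case False
      then have "e = 2" "p = l" using 1 2 shape by (auto simp: L_eq)
      then show ?thesis by simp
    qed simp
  qed
  finally show ?thesis by (simp add: p_def)
qed

definition residue_balanced :: "nat \<Rightarrow> nat multiset \<Rightarrow> bool" where
  "residue_balanced s M \<longleftrightarrow> size {#r \<in># M. r mod L = s#} = size {#r \<in># M. r mod L = L - s#}"

text \<open>The partitions of interest that use, besides multiples of \<open>l\<close>, only the residues \<open>\<plusminus>1, \<dots>, \<plusminus>j\<close>.
  The condition on the size makes the size divided by \<open>l\<close> additive when layers are composed.\<close>

definition layer :: "nat \<Rightarrow> nat multiset set" where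
  "layer j = {M. 0 \<notin># M \<and>
     (\<forall>r\<in>#M. l dvd r \<or> count M r = 1 \<and> (\<exists>s\<in>{1..j}. r mod L = s \<or> r mod L = L - s)) \<and>
     (\<forall>s\<in>{1..j}. residue_balanced s M) \<and> l dvd sum_mset M}"

definition pair_parts :: "nat \<Rightarrow> nat set \<times> nat set \<Rightarrow> nat set" where
  "pair_parts s = (\<lambda>(A, B). (\<lambda>a. a * L + s) ` A \<union> (\<lambda>b. Suc b * L - s) ` B)"

lemma residue_pos: "s \<le> n \<Longrightarrow> (a * L + s) mod L = s"
  using period_bounds by simp

lemma residue_neg:
  assumes "1 \<le> s" "s \<le> n"
  shows "(Suc b * L - s) mod L = L - s"
proof -
  have "Suc b * L - s = (L - s) + b * L" using assms period_bounds by simp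
  moreover have "(L - s) mod L = L - s" using assms period_bounds by simp
  ultimately show ?thesis by (simp only: mod_mult_self1)
qed

lemma residue_neq:
  assumes "s \<in> {1..n}" "s' \<in> {1..n}"
  shows "s \<noteq> L - s'" "s \<noteq> s' \<Longrightarrow> L - s \<noteq> L - s'"
  using assms period_bounds by auto

lemma inj_part_maps:
  shows "inj (\<lambda>a. a * L + s)" and "s \<le> n \<Longrightarrow> inj (\<lambda>b. Suc b * L - s)"
proof -
  show "inj (\<lambda>a. a * L + s)" using period_bounds by (auto simp: inj_def)
  show "inj (\<lambda>b. Suc b * L - s)" if "s \<le> n"
  proof (rule injI)
    fix b c assume *: "Suc b * L - s = Suc c * L - s"
    have "s \<le> Suc b * L" "s \<le> Suc c * L" using that period_bounds by auto
    then have "Suc b * L = Suc c * L" using * by linarith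
    then show "b = c" using period_bounds by simp
  qed
qed

lemma pair_parts_props:
  assumes s: "1 \<le> s" "s \<le> n" and p: "(A, B) \<in> balanced_pairs"
  shows "finite (pair_parts s (A, B))"
    and "{r \<in> pair_parts s (A, B). r mod L = s} = (\<lambda>a. a * L + s) ` A"
    and "{r \<in> pair_parts s (A, B). r mod L = L - s} = (\<lambda>b. Suc b * L - s) ` B"
    and "\<And>r. r \<in> pair_parts s (A, B) \<Longrightarrow> r mod L = s \<or> r mod L = L - s"
    and "a * L + s \<in> pair_parts s (A, B) \<longleftrightarrow> a \<in> A"
    and "Suc b * L - s \<in> pair_parts s (A, B) \<longleftrightarrow> b \<in> B"
    and "\<Sum> (pair_parts s (A, B)) = L * pair_weight (A, B)"
    and "card ((\<lambda>a. a * L + s) ` A) = card ((\<lambda>b. Suc b * L - s) ` B)"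
proof -
  let ?f = "\<lambda>a. a * L + s" and ?g = "\<lambda>b. Suc b * L - s"
  have ne: "s \<noteq> L - s" using residue_neq(1)[of s s] s by simp
  have AB: "finite A" "finite B" "card A = card B" using p by (auto simp: balanced_pairs_def)
  have f: "?f a mod L = s" for a using residue_pos s by blast
  have g: "?g b mod L = L - s" for b using residue_neg s by blast
  have sL: "s \<le> Suc b * L" for b using s period_bounds by simp
  have inj_f: "inj ?f" and inj_g: "inj ?g" using inj_part_maps s by blast+
  have fg: "?f a \<noteq> ?g b" for a b using f g ne by metis
  show "finite (pair_parts s (A, B))" using AB by (simp add: pair_parts_def)
  have res: "r \<in> ?f ` A \<Longrightarrow> r mod L = s" "r \<in> ?g ` B \<Longrightarrow> r mod L = L - s" for r
    using f g by blast+
  show "{r \<in> pair_parts s (A, B). r mod L = s} = ?f ` A"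
    "{r \<in> pair_parts s (A, B). r mod L = L - s} = ?g ` B"
    unfolding pair_parts_def prod.case set_eq_iff mem_Collect_eq Un_iff
    using res ne by metis+
  show "r mod L = s \<or> r mod L = L - s" if "r \<in> pair_parts s (A, B)" for r
    using that f g by (auto simp: pair_parts_def)
  show "?f a \<in> pair_parts s (A, B) \<longleftrightarrow> a \<in> A"
    using fg inj_f by (auto simp: pair_parts_def dest: injD)
  show "?g b \<in> pair_parts s (A, B) \<longleftrightarrow> b \<in> B"
    using fg inj_g unfolding pair_parts_def by (auto dest: injD; metis)
  have "\<Sum> (pair_parts s (A, B)) = (\<Sum>a\<in>A. ?f a) + (\<Sum>b\<in>B. ?g b)"
    unfolding pair_parts_def prod.case using AB fg inj_f inj_g
    by (subst sum.union_disjoint) (auto simp: sum.reindex inj_on_subset[OF _ subset_UNIV])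
  also have "(\<Sum>a\<in>A. ?f a) = L * \<Sum> A + s * card B"
    using AB by (simp add: sum.distrib sum_distrib_left mult.commute)
  also have "\<dots> + (\<Sum>b\<in>B. ?g b) = L * \<Sum> A + (\<Sum>b\<in>B. s + ?g b)"
    by (simp only: sum.distrib) simp
  also have "(\<Sum>b\<in>B. s + ?g b) = (\<Sum>b\<in>B. L * Suc b)"
    using sL by (intro sum.cong) (auto simp: mult.commute)
  finally show "\<Sum> (pair_parts s (A, B)) = L * pair_weight (A, B)"
    by (simp add: pair_weight_def distrib_left sum_distrib_left)
  show "card (?f ` A) = card (?g ` B)"
    using AB inj_f inj_g by (simp add: card_image inj_on_subset[OF _ subset_UNIV])
qed

text \<open>Parts with residue \<open>\<plusminus>(j + 1)\<close> occur in no member of layer \<open>j\<close>, so a member of the next layer is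
  cut into its parts with these residues and the rest. The former are pairwise distinct, hence given
  by two finite sets, and balance of the residue \<open>j + 1\<close> says that the two sets are equinumerous.\<close>

lemma layer_Suc_bij:
  assumes "Suc j \<le> n"
  defines "f \<equiv> (\<lambda>(M, p). M + mset_set (pair_parts (Suc j) p))"
  shows "bij_betw f (layer j \<times> balanced_pairs) (layer (Suc j))"
proof -
  define s where "s = Suc j"
  have s: "1 \<le> s" "s \<le> n" "s \<in> {1..n}" using assms by (auto simp: s_def)
  \<comment> \<open>The residues that are new in layer \<open>j + 1\<close>.\<close>
  define near where "near r \<longleftrightarrow> r mod L = s \<or> r mod L = L - s" for r
  have near_dvd: "\<not> l dvd r" if "near r" for r
    using that s dvd_iff_residue[of r] unfolding near_def by blast
  have near_other: "r mod L \<noteq> s'" "r mod L \<noteq> L - s'" if "near r" "s' \<in> {1..j}" for r s'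
  proof -
    have s': "s' \<in> {1..n}" "s' \<noteq> s" using that s by (auto simp: s_def)
    show "r mod L \<noteq> s'" "r mod L \<noteq> L - s'"
      using that(1) s' s residue_neq[OF s(3) s'(1)] residue_neq[OF s'(1) s(3)]
      unfolding near_def by auto
  qed
  have not_near: "\<not> near r" if "M \<in> layer j" "r \<in># M" for M r
    using that near_dvd near_other unfolding layer_def by blast
  define g where "g M = (filter_mset (\<lambda>r. \<not> near r) M,
    ({a. a * L + s \<in># M}, {b. Suc b * L - s \<in># M}))" for M
  have recover: "mset_set (pair_parts s (snd (g M))) = filter_mset near M"
    and g_bal: "snd (g M) \<in> balanced_pairs" if M: "M \<in> layer (Suc j)" for M
  proof -
    let ?F = "\<lambda>a. a * L + s" and ?G = "\<lambda>b. Suc b * L - s"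
    define A where "A = {a. ?F a \<in># M}"
    define B where "B = {b. ?G b \<in># M}"
    have gM: "snd (g M) = (A, B)" by (simp add: g_def A_def B_def)
    have cnt: "count M r = 1" if "near r" "r \<in># M" for r
      using M that near_dvd unfolding layer_def by blast
    have posI: "r \<in> ?F ` A" if "r mod L = s" "r \<in># M" for r
    proof -
      have eq: "r = ?F (r div L)" using div_mult_mod_eq[of r L] that(1) by simp
      have "?F (r div L) \<in># M" using that(2) by (subst eq[symmetric])
      then show ?thesis unfolding A_def by (intro image_eqI[where x = "r div L"] CollectI) (rule eq)
    qed
    have negI: "r \<in> ?G ` B" if "r mod L = L - s" "r \<in># M" for r
    proof -
      have eq: "r = ?G (r div L)"
        using div_mult_mod_eq[of r L] that(1) s period_bounds by simp
      have "?G (r div L) \<in># M" using that(2) by (subst eq[symmetric])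
      then show ?thesis unfolding B_def by (intro image_eqI[where x = "r div L"] CollectI) (rule eq)
    qed
    have set: "pair_parts s (A, B) = set_mset (filter_mset near M)"
    proof (intro equalityI subsetI)
      fix r assume "r \<in> pair_parts s (A, B)"
      then show "r \<in># filter_mset near M"
        using residue_pos[OF s(2)] residue_neg[OF s(1,2)]
        unfolding pair_parts_def near_def A_def B_def by (auto simp del: mult_Suc)
    next
      fix r assume "r \<in># filter_mset near M"
      then show "r \<in> pair_parts s (A, B)"
        using posI negI unfolding near_def pair_parts_def by auto
    qed
    show mset: "mset_set (pair_parts s (snd (g M))) = filter_mset near M"
      unfolding gM set using cnt
      by (intro multiset_eqI) (auto simp: count_mset_set' not_in_iff)
    have inj_F: "inj ?F" and inj_G: "inj ?G" using inj_part_maps s by blast+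
    have sub: "?F ` A \<subseteq> set_mset M" "?G ` B \<subseteq> set_mset M" by (auto simp: A_def B_def)
    have fin: "finite A" "finite B"
      using finite_subset[OF sub(1) finite_set_mset] finite_subset[OF sub(2) finite_set_mset]
        finite_imageD[OF _ inj_on_subset[OF inj_F subset_UNIV]]
        finite_imageD[OF _ inj_on_subset[OF inj_G subset_UNIV]] by blast+
    have eqA: "{#r \<in># M. r mod L = s#} = mset_set (?F ` A)"
    proof (rule multiset_eqI)
      fix r
      have "count M r = (if r \<in> ?F ` A then 1 else 0)" if "r mod L = s"
        using that cnt[of r] posI[of r] sub(1)
        by (cases "r \<in># M") (simp_all add: near_def not_in_iff, blast dest: not_in_iff[THEN iffD2])
      moreover have "r mod L = s" if "r \<in> ?F ` A" using that residue_pos[OF s(2)] by auto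
      ultimately show "count {#r \<in># M. r mod L = s#} r = count (mset_set (?F ` A)) r"
        using fin by (auto simp: count_mset_set')
    qed
    have eqB: "{#r \<in># M. r mod L = L - s#} = mset_set (?G ` B)"
    proof (rule multiset_eqI)
      fix r
      have "count M r = (if r \<in> ?G ` B then 1 else 0)" if "r mod L = L - s"
        using that cnt[of r] negI[of r] sub(2)
        by (cases "r \<in># M") (simp_all add: near_def not_in_iff, blast dest: not_in_iff[THEN iffD2])
      moreover have "r mod L = L - s" if "r \<in> ?G ` B" using that residue_neg[OF s(1,2)] by blast
      ultimately show "count {#r \<in># M. r mod L = L - s#} r = count (mset_set (?G ` B)) r"
        using fin by (auto simp: count_mset_set')
    qed
    have "residue_balanced s M" using M by (auto simp: layer_def s_def)
    then have "card A = card B"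
      unfolding residue_balanced_def eqA eqB using inj_F inj_G fin
      by (simp add: card_image inj_on_subset[OF _ subset_UNIV])
    then show "snd (g M) \<in> balanced_pairs" using fin by (simp add: gM balanced_pairs_def)
  qed
  show ?thesis
  proof (rule bij_betw_byWitness[where f' = g])
    show "\<forall>x\<in>layer j \<times> balanced_pairs. g (f x) = x"
    proof safe
      fix M A B assume M: "M \<in> layer j" and p: "(A, B) \<in> balanced_pairs"
      note P = pair_parts_props[OF s(1,2) p]
      have "filter_mset (\<lambda>r. \<not> near r) M = M"
        using not_near[OF M] by (simp add: filter_mset_eq_conv)
      moreover have "filter_mset (\<lambda>r. \<not> near r) (mset_set (pair_parts s (A, B))) = {#}"
        using P(1,4) by (auto simp: near_def simp del: filter_mset_mset_set)
      moreover have "a * L + s \<notin># M" "Suc a * L - s \<notin># M" for a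
        using not_near[OF M] residue_pos[OF s(2)] residue_neg[OF s(1,2)]
        unfolding near_def by blast+
      ultimately show "g (f (M, (A, B))) = (M, (A, B))"
        using P(1,5,6) unfolding g_def f_def by (simp add: s_def[symmetric] del: mult_Suc)
    qed
    show "\<forall>M\<in>layer (Suc j). f (g M) = M"
    proof
      fix M assume "M \<in> layer (Suc j)"
      then have "f (g M) = filter_mset (\<lambda>r. \<not> near r) M + filter_mset near M"
        using recover[of M] unfolding f_def s_def[symmetric] by (simp add: g_def)
      then show "f (g M) = M" by (metis add.commute multiset_partition)
    qed
    show "f ` (layer j \<times> balanced_pairs) \<subseteq> layer (Suc j)"
    proof safe
      fix M A B assume M: "M \<in> layer j" and p: "(A, B) \<in> balanced_pairs"
      note P = pair_parts_props[OF s(1,2) p]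
      define D where "D = pair_parts s (A, B)"
      have N: "f (M, (A, B)) = M + mset_set D" by (simp add: f_def D_def s_def)
      have finD: "finite D" using P(1) by (simp add: D_def)
      have nearD: "near r" if "r \<in> D" for r using P(4) that by (simp add: D_def near_def)
      have zero: "0 \<notin> D" using nearD near_dvd by fastforce
      have cntD: "count (M + mset_set D) r = 1" if "r \<in> D" for r
      proof -
        have "r \<notin># M" using nearD[OF that] not_near[OF M] by blast
        then show ?thesis using that finD by (simp add: not_in_iff)
      qed
      have cntM: "count (M + mset_set D) r = count M r" if "r \<in># M" for r
        using not_near[OF M that] nearD finD by (auto simp: count_mset_set')
      have bal: "residue_balanced s' (M + mset_set D)" if "s' \<in> {1..Suc j}" for s'
      proof (cases "s' = s")
        case True
        have "{#r \<in># M. r mod L = s#} = {#}" "{#r \<in># M. r mod L = L - s#} = {#}"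
          using not_near[OF M] by (auto simp: near_def simp del: filter_mset_mset_set)
        moreover have "{#r \<in># mset_set D. r mod L = s#} = mset_set ((\<lambda>a. a * L + s) ` A)"
          "{#r \<in># mset_set D. r mod L = L - s#} = mset_set ((\<lambda>b. Suc b * L - s) ` B)"
          using finD P(2,3) by (simp_all add: filter_mset_mset_set D_def del: mult_Suc)
        ultimately show ?thesis
          using P(8) True
          by (simp add: residue_balanced_def del: mult_Suc filter_mset_eq_mempty_iff filter_mset_mset_set)
      next
        case False
        then have s': "s' \<in> {1..j}" using that by (auto simp: s_def)
        have "{#r \<in># mset_set D. r mod L = s'#} = {#}" "{#r \<in># mset_set D. r mod L = L - s'#} = {#}"
          using near_other[OF nearD s'] finD by (auto simp del: filter_mset_mset_set)
        then show ?thesis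
          using M s' by (simp add: residue_balanced_def layer_def
              del: filter_mset_eq_mempty_iff filter_mset_mset_set)
      qed
      have "sum_mset (mset_set D) = L * pair_weight (A, B)"
        using P(7) by (simp add: D_def sum_unfold_sum_mset)
      then have dvd: "l dvd sum_mset (M + mset_set D)"
        using M dvd_period by (simp add: layer_def)
      have "l dvd r \<or> count (M + mset_set D) r = 1 \<and>
          (\<exists>s'\<in>{1..Suc j}. r mod L = s' \<or> r mod L = L - s')" if "r \<in># M + mset_set D" for r
      proof (cases "r \<in> D")
        case True
        moreover have "s \<in> {1..Suc j}" by (simp add: s_def)
        ultimately show ?thesis using cntD[OF True] nearD[OF True] unfolding near_def by blast
      next
        case False
        then have r: "r \<in># M" using that finD by simp
        then have "l dvd r \<or> count M r = 1 \<and> (\<exists>s'\<in>{1..j}. r mod L = s' \<or> r mod L = L - s')"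
          using M unfolding layer_def by blast
        moreover have "{1..j} \<subseteq> {1..Suc j}" by auto
        ultimately show ?thesis unfolding cntM[OF r] by blast
      qed
      moreover have "0 \<notin># M + mset_set D" using M zero finD by (simp add: layer_def)
      ultimately show "f (M, (A, B)) \<in> layer (Suc j)"
        unfolding N layer_def using bal dvd by blast
    qed
    show "g ` layer (Suc j) \<subseteq> layer j \<times> balanced_pairs"
    proof (intro image_subsetI)
      fix M assume M: "M \<in> layer (Suc j)"
      let ?M = "filter_mset (\<lambda>r. \<not> near r) M"
      obtain A B where p: "snd (g M) = (A, B)" by fastforce
      have "residue_balanced s' ?M" if "s' \<in> {1..j}" for s'
      proof -
        have "filter_mset (\<lambda>r. r mod L = s') ?M = filter_mset (\<lambda>r. r mod L = s') M"
          "filter_mset (\<lambda>r. r mod L = L - s') ?M = filter_mset (\<lambda>r. r mod L = L - s') M"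
          using near_other that by (auto simp: filter_filter_mset intro!: filter_mset_cong)
        then show ?thesis using M that by (simp add: residue_balanced_def layer_def)
      qed
      moreover have dvd: "l dvd sum_mset ?M"
      proof -
        have "sum_mset (filter_mset near M) = L * pair_weight (A, B)"
          using pair_parts_props(7)[OF s(1,2), of A B] recover[OF M] g_bal[OF M]
          by (simp add: p sum_unfold_sum_mset)
        moreover have "sum_mset M = sum_mset (filter_mset near M) + sum_mset ?M"
          by (metis multiset_partition sum_mset.union)
        ultimately show ?thesis
          using M dvd_period by (auto simp: layer_def dvd_add_right_iff)
      qed
      have far: "\<exists>s'\<in>{1..j}. r mod L = s' \<or> r mod L = L - s'"
        if "\<not> near r" "\<exists>s'\<in>{1..Suc j}. r mod L = s' \<or> r mod L = L - s'" for r
        using that unfolding near_def s_def by (metis atLeastAtMost_iff le_Suc_eq)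
      have "l dvd r \<or> count ?M r = 1 \<and> (\<exists>s'\<in>{1..j}. r mod L = s' \<or> r mod L = L - s')"
        if "r \<in># ?M" for r
      proof -
        have r: "r \<in># M" "\<not> near r" using that by auto
        then have "l dvd r \<or> count M r = 1 \<and> (\<exists>s'\<in>{1..Suc j}. r mod L = s' \<or> r mod L = L - s')"
          using M unfolding layer_def by blast
        moreover have "count ?M r = count M r" using r by simp
        ultimately show ?thesis using far[OF r(2)] by metis
      qed
      moreover have "0 \<notin># ?M" using M by (simp add: layer_def)
      ultimately have "?M \<in> layer j" unfolding layer_def using dvd by blast
      then show "g M \<in> layer j \<times> balanced_pairs"
        using g_bal[OF M] by (simp add: g_def)
    qed
  qed
qed

lemma finite_layer: "finite {M \<in> layer j. sum_mset M div l = m}"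
proof (rule finite_subset[OF _ finite_multisets_sum])
  show "{M \<in> layer j. sum_mset M div l = m} \<subseteq> {M. 0 \<notin># M \<and> sum_mset M = l * m}"
    by (auto simp: layer_def)
qed

lemma layer_0_bij: "bij_betw (image_mset ((*) l)) {M. 0 \<notin># M} (layer 0)"
proof (rule bij_betw_byWitness[where f' = "image_mset (\<lambda>r. r div l)"])
  have l: "l > 0" by (rule period_bounds)
  show "\<forall>M\<in>{M. 0 \<notin># M}. image_mset (\<lambda>r. r div l) (image_mset ((*) l) M) = M"
    using l by (simp add: multiset.map_comp comp_def)
  show "\<forall>M\<in>layer 0. image_mset ((*) l) (image_mset (\<lambda>r. r div l) M) = M"
  proof
    fix M assume M: "M \<in> layer 0"
    have "image_mset (\<lambda>r. l * (r div l)) M = image_mset (\<lambda>r. r) M"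
      using M by (intro image_mset_cong) (auto simp: layer_def)
    then show "image_mset ((*) l) (image_mset (\<lambda>r. r div l) M) = M"
      by (simp add: multiset.map_comp comp_def)
  qed
  have "l dvd sum_mset (image_mset ((*) l) M)" for M
    by (induction M) auto
  then show "image_mset ((*) l) ` {M. 0 \<notin># M} \<subseteq> layer 0"
    using l by (auto simp: layer_def)
  show "image_mset (\<lambda>r. r div l) ` layer 0 \<subseteq> {M. 0 \<notin># M}"
    using l by (auto simp: layer_def dvd_div_eq_0_iff)
qed

text \<open>Adding the residues \<open>\<plusminus>(j + 1)\<close> multiplies the generating function by that of the balanced pairs,
  since the size of the parts encoded by a pair is \<open>L = el\<close> times its weight.\<close>

lemma layer_gf:
  "j \<le> n \<Longrightarrow> gf (layer j) (\<lambda>M. sum_mset M div l) * (qpoch_inf 1 * qpoch_inf e ^ j) = 1"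
proof (induction j)
  case 0
  have "sum_mset (image_mset ((*) l) M) div l = sum_mset M" for M
    using period_bounds(2) by (simp flip: sum_mset_distrib_left)
  then have "gf {M. 0 \<notin># M} sum_mset = gf (layer 0) (\<lambda>M. sum_mset M div l)"
    by (intro gf_bij[OF layer_0_bij])
  then show ?case using partitions_gf by simp
next
  case (Suc j)
  let ?w = "\<lambda>M. sum_mset M div l" and ?v = "\<lambda>p. e * pair_weight p"
  have "gf (layer j \<times> balanced_pairs) (\<lambda>(M, p). ?w M + ?v p) = gf (layer (Suc j)) ?w"
  proof (rule gf_bij[OF layer_Suc_bij[OF Suc.prems]], clarify)
    fix M A B assume p: "(A, B) \<in> balanced_pairs"
    have "sum_mset (mset_set (pair_parts (Suc j) (A, B))) = l * (e * pair_weight (A, B))"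
      using pair_parts_props(7)[OF _ Suc.prems p] by (simp add: sum_unfold_sum_mset L_eq)
    then show "?w (M + mset_set (pair_parts (Suc j) (A, B))) = ?w M + ?v (A, B)"
      using period_bounds(2) by simp
  qed
  then have "gf (layer (Suc j)) ?w = gf (layer j) ?w * gf balanced_pairs ?v"
    using gf_times[of "layer j" ?w balanced_pairs ?v] finite_layer
      finite_balanced_pairs[OF period_bounds(1)] by simp
  then have "gf (layer (Suc j)) ?w * (qpoch_inf 1 * qpoch_inf e ^ Suc j)
      = (gf (layer j) ?w * (qpoch_inf 1 * qpoch_inf e ^ j)) * (gf balanced_pairs ?v * qpoch_inf e)"
    by (simp only: mult_ac power_Suc)
  also have "\<dots> = 1"
    using Suc balanced_pairs_gf[OF period_bounds(1)] by simp
  finally show ?case .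
qed


subsection \<open>Content and residues\<close>

definition residue_count :: "nat \<Rightarrow> nat \<Rightarrow> nat" where
  "residue_count p r = card {j. j < r \<and> j mod L = p}"

lemma residue_count_add: "residue_count p (Suc r) = residue_count p r + (if r mod L = p then 1 else 0)"
proof -
  have "{j. j < Suc r \<and> j mod L = p}
      = (if r mod L = p then insert r {j. j < r \<and> j mod L = p} else {j. j < r \<and> j mod L = p})"
    by (auto simp: less_Suc_eq)
  then show ?thesis by (simp add: residue_count_def)
qed

lemma residue_count_step:
  assumes "Suc p < L"
  shows "residue_count p r = residue_count (Suc p) r + (if r mod L = Suc p then 1 else 0)"
proof (induction r)
  case 0
  then show ?case by (simp add: residue_count_def)
next
  case (Suc r)
  have "Suc r mod L = Suc p \<longleftrightarrow> r mod L = p"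
    using assms by (auto simp: mod_Suc)
  then show ?case using Suc by (simp add: residue_count_add)
qed

lemma residue_count_total: "(\<Sum>p<L. residue_count p r) = r"
proof (induction r)
  case 0
  then show ?case by (simp add: residue_count_def)
next
  case (Suc r)
  have "r mod L < L" using period_bounds by simp
  then show ?case using Suc by (simp add: residue_count_add sum.distrib)
qed

text \<open>The number of blocks of a wall with column sizes \<open>M\<close> whose position in the column, counted from
  the ground, is congruent to \<open>p\<close>.\<close>

definition blocks_at :: "nat \<Rightarrow> nat multiset \<Rightarrow> nat" where
  "blocks_at p M = (\<Sum>r\<in>#M. residue_count p r)"

lemma blocks_at_step:
  assumes "Suc p < L"
  shows "blocks_at p M = blocks_at (Suc p) M + size {#r \<in># M. r mod L = Suc p#}"
proof (induction M)
  case (add r M)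
  then show ?case using residue_count_step[OF assms, of r] by (simp add: blocks_at_def)
qed (simp add: blocks_at_def)

lemma blocks_at_total: "(\<Sum>p<L. blocks_at p M) = sum_mset M"
proof (induction M)
  case (add r M)
  then show ?case using residue_count_total[of r] by (simp add: blocks_at_def sum.distrib)
qed (simp add: blocks_at_def)

text \<open>By the palindromic symmetry the blocks at positions \<open>p\<close> and \<open>L - 1 - p\<close> have the same color. Let
  \<open>K p\<close> be their total number. Moving from \<open>p\<close> to \<open>p + 1\<close> changes \<open>K\<close> by the difference between the
  numbers of parts with residues \<open>-(p + 1)\<close> and \<open>p + 1\<close> (\<open>blocks_at_step\<close>), so \<open>K\<close> is constant exactly
  when all residues are balanced. Its constant value is determined by summation over one period,
  which counts each block twice. The condition on \<open>K\<close> says \<open>K p = m\<close> in type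
  \<open>D_{n+1}^{(2)}\<close> and \<open>K p = 2m\<close> in type \<open>A_{2n}^{(2)}\<close>. In the latter the central position
  \<open>p = n = L - 1 - p\<close> is counted twice, in accordance with the coefficient \<open>1\<close> of \<open>\<alpha>\<^sub>n\<close> in \<open>\<delta>\<close>.\<close>

lemma content_iff:
  "(\<forall>p<L. e * (blocks_at p M + blocks_at (L - 1 - p) M) = 2 * m) \<longleftrightarrow>
     (\<forall>s. 0 < s \<and> s < L \<longrightarrow> residue_balanced s M) \<and> sum_mset M = m * l"
proof -
  define K where "K p = blocks_at p M + blocks_at (L - 1 - p) M" for p
  have step: "residue_balanced (Suc p) M \<longleftrightarrow> K p = K (Suc p)" if "Suc p < L" for p
  proof -
    have "Suc (L - 1 - Suc p) = L - 1 - p" "Suc (L - 1 - Suc p) < L" using that by auto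
    then have low: "blocks_at (L - 1 - Suc p) M
        = blocks_at (L - 1 - p) M + size {#r \<in># M. r mod L = L - Suc p#}"
      using blocks_at_step[of "L - 1 - Suc p" M] by simp
    show ?thesis
      unfolding K_def residue_balanced_def low blocks_at_step[OF that, of M] by auto
  qed
  have total: "(\<Sum>p<L. K p) = 2 * sum_mset M"
  proof -
    have "(\<Sum>p<L. blocks_at (L - 1 - p) M) = (\<Sum>p<L. blocks_at p M)"
      using sum.nat_diff_reindex[of "\<lambda>p. blocks_at p M" L] by simp
    then show ?thesis by (simp add: K_def sum.distrib blocks_at_total)
  qed
  \<comment> \<open>Summing \<open>K\<close> over one period counts every block twice.\<close>
  have total_const: "e * l * K 0 = 2 * sum_mset M" if "\<And>p. p < L \<Longrightarrow> K p = K 0"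
  proof -
    have "(\<Sum>p<L. K p) = (\<Sum>p<L. K 0)" by (intro sum.cong refl that) simp
    then show ?thesis using total by (simp add: L_eq)
  qed
  have L0: "0 < L" and e0: "0 < e" and l0: "0 < l" by (rule period_bounds)+
  show ?thesis unfolding K_def[symmetric]
  proof (intro iffI conjI allI impI)
    assume *: "\<forall>p<L. e * K p = 2 * m"
    have eq: "K p = K 0" if "p < L" for p
    proof -
      have "e * K p = e * K 0" using * that L0 by simp
      then show ?thesis using e0 by simp
    qed
    show "residue_balanced s M" if "0 < s \<and> s < L" for s
    proof -
      have "K (s - 1) = K s" using eq[of s] eq[of "s - 1"] that by linarith
      then show ?thesis using step[of "s - 1"] that by simp
    qed
    have "l * (e * K 0) = 2 * sum_mset M" using total_const[OF eq] by (simp add: mult_ac)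
    then show "sum_mset M = m * l" using * L0 by (simp add: mult.commute)
  next
    fix p
    assume *: "(\<forall>s. 0 < s \<and> s < L \<longrightarrow> residue_balanced s M) \<and> sum_mset M = m * l" and p: "p < L"
    have eq: "K p = K 0" if "p < L" for p
      using that
    proof (induction p)
      case (Suc p)
      then show ?case using step[of p] * by simp
    qed simp
    have "l * (e * K 0) = l * (2 * m)" using total_const[OF eq] * by (simp add: mult_ac)
    then show "e * K p = 2 * m" using l0 eq[OF p] by simp
  qed
qed

text \<open>The residues outside \<open>{1..n}\<close> are negatives of those inside, except the residue \<open>l = L - l\<close> in
  type \<open>D_{n+1}^{(2)}\<close>, for which balance is trivial.\<close>

lemma residue_balanced_all:
  "(\<forall>s. 0 < s \<and> s < L \<longrightarrow> residue_balanced s M) \<longleftrightarrow> (\<forall>s\<in>{1..n}. residue_balanced s M)"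
proof (intro iffI ballI allI impI)
  fix s assume *: "\<forall>s\<in>{1..n}. residue_balanced s M" and s: "0 < s \<and> s < L"
  consider "s \<in> {1..n}" | "L - s \<in> {1..n}" | "L - s = s"
    using s shape by (cases "s \<le> n"; cases "L - s \<le> n") (auto simp: L_eq)
  then show "residue_balanced s M"
  proof cases
    case 2
    then have "residue_balanced (L - s) M" using * by blast
    then show ?thesis using s by (simp add: residue_balanced_def)
  qed (use * in \<open>auto simp: residue_balanced_def\<close>)
qed (use period_bounds in auto)

lemma layer_n_iff:
  "M \<in> layer n \<and> sum_mset M div l = m \<longleftrightarrow>
     0 \<notin># M \<and> (\<forall>r\<in>#M. l dvd r \<or> count M r = 1) \<and>
     (\<forall>p<L. e * (blocks_at p M + blocks_at (L - 1 - p) M) = 2 * m)"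
proof -
  have "l dvd r \<or> count M r = 1 \<and> (\<exists>s\<in>{1..n}. r mod L = s \<or> r mod L = L - s) \<longleftrightarrow>
      l dvd r \<or> count M r = 1" for r
    using dvd_iff_residue[of r] by blast
  moreover have "l dvd sum_mset M \<and> sum_mset M div l = m \<longleftrightarrow> sum_mset M = m * l"
    using period_bounds(2) by auto
  ultimately show ?thesis
    unfolding layer_def content_iff residue_balanced_all by auto
qed

end


section \<open>Walls as multisets of column sizes\<close>

definition column_parts :: "wall \<Rightarrow> nat multiset" where
  "column_parts Y = image_mset Y (mset_set {k. Y k \<noteq> 0})"

lemma count_column_parts:
  assumes "finite {k. Y k \<noteq> 0}" "r \<noteq> 0"
  shows "count (column_parts Y) r = card {k. Y k = r}"
proof -
  have eq: "Y -` {r} \<inter> {k. Y k \<noteq> 0} = {k. Y k = r}" using assms(2) by auto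
  have "count (column_parts Y) r = (\<Sum>k | Y k = r. count (mset_set {k. Y k \<noteq> 0}) k)"
    unfolding column_parts_def count_image_mset using assms(1) eq by simp
  also have "\<dots> = (\<Sum>k | Y k = r. 1)"
    using assms by (intro sum.cong) auto
  finally show ?thesis by simp
qed

text \<open>The columns of size at least \<open>v\<close> form an initial segment, and its length can be read off from the
  multiset of sizes.\<close>

lemma antimono_determined_by_column_parts:
  assumes "finite {k. Y k \<noteq> 0}" "antimono Y" "0 < v"
  shows "v \<le> Y k \<longleftrightarrow> k < size {#r \<in># column_parts Y. v \<le> r#}"
proof -
  let ?D = "{k. v \<le> Y k}"
  have fin: "finite ?D"
    by (rule finite_subset[OF _ assms(1)]) (use assms(3) in auto)
  have "size {#r \<in># column_parts Y. v \<le> r#} = card {k \<in> {k. Y k \<noteq> 0}. v \<le> Y k}"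
    using assms(1) by (simp add: column_parts_def filter_mset_image_mset)
  also have "{k \<in> {k. Y k \<noteq> 0}. v \<le> Y k} = ?D" using assms(3) by auto
  finally have size: "size {#r \<in># column_parts Y. v \<le> r#} = card ?D" .
  have down: "j \<in> ?D" if "k \<in> ?D" "j \<le> k" for j k
    using that antimonoD[OF assms(2), of j k] by auto
  show ?thesis
  proof
    assume "v \<le> Y k"
    then have "{..k} \<subseteq> ?D" using down by blast
    then have "card {..k} \<le> card ?D" using fin by (rule card_mono[rotated])
    then show "k < size {#r \<in># column_parts Y. v \<le> r#}" by (simp add: size)
  next
    assume k: "k < size {#r \<in># column_parts Y. v \<le> r#}"
    show "v \<le> Y k"
    proof (rule ccontr)
      assume "\<not> v \<le> Y k"
      then have "?D \<subseteq> {..<k}" using down by (force simp: not_le)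
      then have "card ?D \<le> k" using card_mono[of "{..<k}"] by fastforce
      then show False using k size by simp
    qed
  qed
qed

lemma column_parts_bij:
  "bij_betw column_parts {Y. finite {k. Y k \<noteq> 0} \<and> antimono Y} {M. 0 \<notin># M}"
  (is "bij_betw _ ?S ?T")
  unfolding bij_betw_def
proof
  show "inj_on column_parts ?S"
  proof (rule inj_onI, rule ext)
    fix Y Z k assume Y: "Y \<in> ?S" and Z: "Z \<in> ?S" and eq: "column_parts Y = column_parts Z"
    have "v \<le> Y k \<longleftrightarrow> v \<le> Z k" if "0 < v" for v
      using Y Z eq that by (simp add: antimono_determined_by_column_parts)
    from this[of "Y k"] this[of "Z k"] show "Y k = Z k"
      by (cases "Y k = 0"; cases "Z k = 0") auto
  qed
  show "column_parts ` ?S = ?T"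
  proof (intro equalityI subsetI)
    fix M assume "M \<in> column_parts ` ?S"
    then show "M \<in> ?T" by (auto simp: column_parts_def)
  next
    fix M assume M: "M \<in> ?T"
    define xs where "xs = rev (sorted_list_of_multiset M)"
    have mset: "mset xs = M" by (simp add: xs_def)
    define Y where "Y k = (if k < length xs then xs ! k else 0)" for k
    have "xs ! k \<noteq> 0" if "k < length xs" for k
      using M mset nth_mem[OF that] by (metis mem_Collect_eq set_mset_mset)
    then have supp: "{k. Y k \<noteq> 0} = {..<length xs}" by (auto simp: Y_def)
    have "antimono Y"
    proof (rule antimonoI)
      fix i j :: nat assume "i \<le> j"
      moreover have "sorted (rev xs)" by (simp add: xs_def)
      ultimately show "Y j \<le> Y i" by (auto simp: Y_def intro: sorted_rev_nth_mono)
    qed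
    moreover have "column_parts Y = M"
    proof -
      have "column_parts Y = image_mset ((!) xs) (mset_set {..<length xs})"
        unfolding column_parts_def supp by (intro image_mset_cong) (simp add: Y_def)
      also have "\<dots> = mset (map ((!) xs) [0..<length xs])"
        by (simp add: mset_set_upto_eq_mset_upto)
      finally show ?thesis by (simp add: map_nth mset)
    qed
    ultimately show "M \<in> column_parts ` ?S" using supp by (intro image_eqI[of _ _ Y]) auto
  qed
qed

lemma column_parts_distinct_iff:
  assumes "finite {k. Y k \<noteq> 0}" and "l > 0"
  shows "(\<forall>k k'. k \<noteq> k' \<and> \<not> l dvd Y k \<and> \<not> l dvd Y k' \<longrightarrow> Y k \<noteq> Y k') \<longleftrightarrow>
         (\<forall>r\<in>#column_parts Y. l dvd r \<or> count (column_parts Y) r = 1)"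
proof
  assume *: "\<forall>k k'. k \<noteq> k' \<and> \<not> l dvd Y k \<and> \<not> l dvd Y k' \<longrightarrow> Y k \<noteq> Y k'"
  show "\<forall>r\<in>#column_parts Y. l dvd r \<or> count (column_parts Y) r = 1"
  proof
    fix r assume r: "r \<in># column_parts Y"
    then obtain k where k: "Y k = r" "r \<noteq> 0" using assms(1) by (auto simp: column_parts_def)
    show "l dvd r \<or> count (column_parts Y) r = 1"
    proof (cases "l dvd r")
      case False
      then have "k' = k" if "Y k' = r" for k' using * k(1) that by metis
      then have "{k'. Y k' = r} = {k}" using k(1) by blast
      then show ?thesis using count_column_parts[OF assms(1) k(2)] by simp
    qed simp
  qed
next
  assume *: "\<forall>r\<in>#column_parts Y. l dvd r \<or> count (column_parts Y) r = 1"
  show "\<forall>k k'. k \<noteq> k' \<and> \<not> l dvd Y k \<and> \<not> l dvd Y k' \<longrightarrow> Y k \<noteq> Y k'"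
  proof (intro allI impI notI)
    fix k k' assume k: "k \<noteq> k' \<and> \<not> l dvd Y k \<and> \<not> l dvd Y k'" and eq: "Y k = Y k'"
    have 0: "Y k \<noteq> 0" using k by (metis dvd_0_right)
    then have "Y k \<in># column_parts Y" using assms(1) by (auto simp: column_parts_def)
    then have "card {k'. Y k' = Y k} = 1" using * k count_column_parts[OF assms(1) 0] by auto
    then obtain x where "{k'. Y k' = Y k} = {x}" using card_1_singletonE by blast
    moreover have "k \<in> {k'. Y k' = Y k}" "k' \<in> {k'. Y k' = Y k}" using eq by auto
    ultimately show False using k by (metis singletonD)
  qed
qed

lemma num_blocks_column_parts:
  assumes "finite {k. Y k \<noteq> 0}"
  shows "num_blocks X n \<Lambda> Y i
    = (\<Sum>r\<in>#column_parts Y. card {j. j < r \<and> block_color X n \<Lambda> j = i})"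
proof -
  have "{(k, j). j < Y k \<and> block_color X n \<Lambda> j = i}
      = (SIGMA k:{k. Y k \<noteq> 0}. {j. j < Y k \<and> block_color X n \<Lambda> j = i})"
    by auto
  then have "num_blocks X n \<Lambda> Y i
      = (\<Sum>k | Y k \<noteq> 0. card {j. j < Y k \<and> block_color X n \<Lambda> j = i})"
    unfolding num_blocks_def using assms by (simp add: card_SigmaI)
  then show ?thesis
    by (simp add: column_parts_def multiset.map_comp comp_def sum_unfold_sum_mset)
qed


section \<open>Colors\<close>

text \<open>The sum of the coefficients of the null root.\<close>

definition delta_height :: "affine_type \<Rightarrow> nat \<Rightarrow> nat" where
  "delta_height X n = (case X of TwA \<Rightarrow> 2 * n + 1 | TwD \<Rightarrow> n + 1)"

definition period :: "affine_type \<Rightarrow> nat \<Rightarrow> nat" where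
  "period X n = eps X * delta_height X n"

text \<open>The coefficients of the simple roots in the null root.\<close>

definition mark :: "affine_type \<Rightarrow> nat \<Rightarrow> nat \<Rightarrow> nat" where
  "mark X n i = (case X of TwA \<Rightarrow> if i = n then 1 else 2 | TwD \<Rightarrow> 1)"

lemma wall_period_admissible:
  "admissible_rank X n \<Longrightarrow> wall_period (eps X) n (delta_height X n) (period X n)"
  by unfold_locales (cases X; auto simp: eps_def delta_height_def period_def)+

lemma ground_color_cases:
  assumes "admissible_rank X n" "\<Lambda> \<in> level_one_weights X n"
  shows "ground_color n \<Lambda> = 0 \<or> X = TwD \<and> ground_color n \<Lambda> = n"
  using assms by (auto simp: level_one_weights_eq ground_color_def split: affine_type.splits)

text \<open>For the ground color \<open>n\<close> the pattern is obtained from that for the ground color \<open>0\<close> by the diagram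
  automorphism \<open>i \<mapsto> n - i\<close>.\<close>

lemma block_color_iff:
  assumes "admissible_rank X n" "\<Lambda> \<in> level_one_weights X n" "i \<le> n"
  defines "d \<equiv> if ground_color n \<Lambda> = 0 then i else n - i"
  shows "block_color X n \<Lambda> j = i \<longleftrightarrow>
    j mod period X n = d \<or> j mod period X n = period X n - 1 - d"
proof -
  define p where "p = j mod period X n"
  have len: "length (stacking_pattern X n \<Lambda>) = period X n"
    by (cases X) (auto simp: stacking_pattern_def period_def delta_height_def eps_def)
  have "p < period X n"
    unfolding p_def by (cases X) (auto simp: period_def delta_height_def eps_def)
  have color: "block_color X n \<Lambda> j = stacking_pattern X n \<Lambda> ! p"
    by (simp add: block_color_def len p_def)
  show ?thesis
  proof (cases X)
    case TwA
    then have "ground_color n \<Lambda> = 0" using ground_color_cases[OF assms(1,2)] by simp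
    then show ?thesis
      using TwA assms(3) \<open>p < period X n\<close> unfolding color p_def[symmetric] d_def
      by (auto simp: stacking_pattern_def period_def delta_height_def eps_def nth_append rev_nth
          simp del: upt_Suc)
  next
    case TwD
    then show ?thesis
      using assms(3) \<open>p < period X n\<close> unfolding color p_def[symmetric] d_def
      by (auto simp: stacking_pattern_def period_def delta_height_def eps_def nth_append rev_nth
          simp del: upt_Suc)
  qed
qed

text \<open>A color \<open>i\<close> sits at two positions of the period, except in the middle of the palindrome in type
  \<open>A_{2n}^{(2)}\<close>, where there is one. In all cases \<open>\<epsilon>\<close> times the coefficient of \<open>\<alpha>\<^sub>i\<close> in \<open>\<delta>\<close> is the number
  of positions.\<close>

lemma num_blocks_null_iff:
  assumes "admissible_rank X n" "\<Lambda> \<in> level_one_weights X n" "finite {k. Y k \<noteq> 0}"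
  shows "(\<forall>i\<le>n. num_blocks X n \<Lambda> Y i = m * mark X n i) \<longleftrightarrow>
    (\<forall>p<period X n. eps X * (wall_period.blocks_at (period X n) p (column_parts Y) +
        wall_period.blocks_at (period X n) (period X n - 1 - p) (column_parts Y)) = 2 * m)"
proof -
  interpret wall_period "eps X" n "delta_height X n" "period X n"
    by (rule wall_period_admissible) fact
  let ?L = "period X n"
  let ?b = "\<lambda>p. blocks_at p (column_parts Y)"
  define d where "d i = (if ground_color n \<Lambda> = 0 then i else n - i)" for i
  have L: "?L = 2 * n + eps X"
    by (cases X) (auto simp: period_def delta_height_def eps_def)
  have eps: "eps X = 1 \<or> eps X = 2" by (cases X) (auto simp: eps_def)
  have count: "card {j. j < r \<and> block_color X n \<Lambda> j = i} =
      (if d i = ?L - 1 - d i then residue_count (d i) r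
       else residue_count (d i) r + residue_count (?L - 1 - d i) r)" if "i \<le> n" for i r
  proof -
    have "{j. j < r \<and> block_color X n \<Lambda> j = i}
        = {j. j < r \<and> j mod ?L = d i} \<union> {j. j < r \<and> j mod ?L = ?L - 1 - d i}"
      using block_color_iff[OF assms(1,2) that] unfolding d_def by auto
    moreover have "card \<dots> = residue_count (d i) r + residue_count (?L - 1 - d i) r"
      if "d i \<noteq> ?L - 1 - d i"
      unfolding residue_count_def using that by (intro card_Un_disjoint) auto
    ultimately show ?thesis by (auto simp: residue_count_def)
  qed
  have blocks: "num_blocks X n \<Lambda> Y i =
      (if d i = ?L - 1 - d i then ?b (d i) else ?b (d i) + ?b (?L - 1 - d i))" if "i \<le> n" for i
    unfolding num_blocks_column_parts[OF assms(3)] count[OF that] blocks_at_def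
    by (simp add: sum_mset.distrib)
  have d_le: "d i \<le> n" if "i \<le> n" for i using that by (simp add: d_def)
  have mark: "eps X * mark X n i = (if d i = ?L - 1 - d i then 1 else 2)" if "i \<le> n" for i
    using that ground_color_cases[OF assms(1,2)] L
    by (cases X) (auto simp: mark_def eps_def d_def)
  have one: "num_blocks X n \<Lambda> Y i = m * mark X n i \<longleftrightarrow>
      eps X * (?b (d i) + ?b (?L - 1 - d i)) = 2 * m" if "i \<le> n" for i
proof -
    let ?N = "num_blocks X n \<Lambda> Y i"
    have "?N = m * mark X n i \<longleftrightarrow> eps X * ?N = m * (eps X * mark X n i)"
      using eps by (auto simp: mult.left_commute)
    also have "\<dots> \<longleftrightarrow> eps X * (?b (d i) + ?b (?L - 1 - d i)) = 2 * m"
    proof (cases "d i = ?L - 1 - d i")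
      case True
      then have "eps X * mark X n i = 1" "?N = ?b (d i)" "?b (?L - 1 - d i) = ?b (d i)"
        using mark[OF that] blocks[OF that] by auto
      moreover have "eps X = 1" using \<open>eps X * mark X n i = 1\<close> by simp
      ultimately show ?thesis by auto
    next
      case False
      then have "eps X * mark X n i = 2" "?N = ?b (d i) + ?b (?L - 1 - d i)"
        using mark[OF that] blocks[OF that] by auto
      then show ?thesis by (simp add: mult.commute)
    qed
    finally show ?thesis .
  qed
  show ?thesis
  proof (intro iffI allI impI)
    fix p assume *: "\<forall>i\<le>n. num_blocks X n \<Lambda> Y i = m * mark X n i" and p: "p < ?L"
    have low: "eps X * (?b q + ?b (?L - 1 - q)) = 2 * m" if "q \<le> n" for q
    proof -
      define i where "i = (if ground_color n \<Lambda> = 0 then q else n - q)"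
      have "i \<le> n" "d i = q" using that by (auto simp: i_def d_def)
      then show ?thesis using one[of i] * by simp
    qed
    show "eps X * (?b p + ?b (?L - 1 - p)) = 2 * m"
    proof (cases "p \<le> n")
      case False
      then have "?L - 1 - p \<le> n" "?L - 1 - (?L - 1 - p) = p" using p L eps by auto
      then show ?thesis using low[of "?L - 1 - p"] by (simp add: add.commute)
    qed (rule low)
  next
    fix i assume *: "\<forall>p<?L. eps X * (?b p + ?b (?L - 1 - p)) = 2 * m" and i: "i \<le> n"
    have "d i < ?L" using d_le[OF i] L eps by auto
    then show "num_blocks X n \<Lambda> Y i = m * mark X n i" using one[OF i] * by blast
  qed
qed


section \<open>Heights and full columns\<close>

text \<open>The half-height blocks lie directly above and directly below the multiples of \<open>l\<close>.\<close>

lemma block_height_color: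
  assumes "admissible_rank X n" "\<Lambda> \<in> level_one_weights X n"
  shows "block_height X n (block_color X n \<Lambda> j) =
    (if delta_height X n dvd j \<or> delta_height X n dvd Suc j then 1 / 2 else 1)"
proof -
  interpret wall_period "eps X" n "delta_height X n" "period X n"
    by (rule wall_period_admissible) fact
  let ?L = "period X n" and ?l = "delta_height X n"
  define p where "p = j mod ?L"
  have p: "p < ?L" using period_bounds by (simp add: p_def)
  have dvd: "?l dvd j + i \<longleftrightarrow> ?l dvd p + i" for i
  proof -
    have "?l dvd j + i \<longleftrightarrow> ?l dvd (j + i) mod ?L" using dvd_period by (simp add: dvd_mod_iff)
    also have "(j + i) mod ?L = (p + i) mod ?L" by (simp add: p_def mod_add_left_eq)
    also have "?l dvd \<dots> \<longleftrightarrow> ?l dvd p + i" using dvd_period by (simp add: dvd_mod_iff)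
    finally show ?thesis .
  qed
  have small: "?l dvd k \<longleftrightarrow> k = 0 \<or> k = ?l \<or> X = TwD \<and> k = 2 * ?l" if "k \<le> ?L" for k
  proof
    assume "?l dvd k"
    then obtain c where c: "k = ?l * c" by blast
    then have "c \<le> eps X" using that period_bounds by (simp add: period_def)
    then have "c = 0 \<or> c = 1 \<or> X = TwD \<and> c = 2" by (cases X) (auto simp: eps_def)
    then show "k = 0 \<or> k = ?l \<or> X = TwD \<and> k = 2 * ?l" using c by auto
  qed auto
  have c0: "block_color X n \<Lambda> j = 0 \<longleftrightarrow> (if ground_color n \<Lambda> = 0 then p = 0 \<or> p = ?L - 1
      else p = n \<or> p = ?L - 1 - n)"
    using block_color_iff[OF assms, of 0 j] by (simp add: p_def)
  have cn: "block_color X n \<Lambda> j = n \<longleftrightarrow> (if ground_color n \<Lambda> = 0 then p = n \<or> p = ?L - 1 - n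
      else p = 0 \<or> p = ?L - 1)"
    using block_color_iff[OF assms, of n j] by (simp add: p_def)
  have "?l dvd j \<or> ?l dvd Suc j \<longleftrightarrow>
      block_color X n \<Lambda> j = 0 \<or> X = TwD \<and> block_color X n \<Lambda> j = n"
    unfolding c0 cn dvd[of 0, simplified] dvd[of 1, simplified]
    using small[of p] small[of "Suc p"] p ground_color_cases[OF assms]
    by (cases X) (auto simp: period_def delta_height_def eps_def)
  then show ?thesis by (simp add: block_height_def)
qed

definition height :: "affine_type \<Rightarrow> nat \<Rightarrow> weight \<Rightarrow> nat \<Rightarrow> rat" where
  "height X n \<Lambda> r =
    block_height X n (ground_color n \<Lambda>) + (\<Sum>j<r. block_height X n (block_color X n \<Lambda> j))"

lemma strict_mono_height: "strict_mono (height X n \<Lambda>)"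
  by (simp add: strict_mono_Suc_iff height_def block_height_def)

text \<open>Each half-height block toggles integrality. The ground block and the block above it together make
  an integer, and thereafter half-height blocks come in adjacent pairs around the multiples of \<open>l\<close>.\<close>

lemma height_in_Ints_iff:
  assumes "admissible_rank X n" "\<Lambda> \<in> level_one_weights X n"
  shows "height X n \<Lambda> r \<in> \<int> \<longleftrightarrow> \<not> delta_height X n dvd r"
proof -
  let ?l = "delta_height X n"
  have l: "?l > 1" using assms(1) by (cases X) (auto simp: delta_height_def)
  have "height X n \<Lambda> r - (if ?l dvd r then 1 / 2 else 0) \<in> \<int>"
  proof (induction r)
    case 0
    then show ?case using ground_color_cases[OF assms] by (auto simp: height_def block_height_def)
  next
    case (Suc r)
    have not_both: "\<not> (?l dvd r \<and> ?l dvd Suc r)"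
      using l by (metis dvd_1_iff_1 dvd_add_right_iff Suc_eq_plus1 less_irrefl One_nat_def)
    have "height X n \<Lambda> (Suc r) = height X n \<Lambda> r +
        (if ?l dvd r \<or> ?l dvd Suc r then 1 / 2 else 1)"
      by (simp add: height_def block_height_color[OF assms])
    then have "height X n \<Lambda> (Suc r) - (if ?l dvd Suc r then 1 / 2 else 0)
        = (height X n \<Lambda> r - (if ?l dvd r then 1 / 2 else 0)) + (if ?l dvd Suc r then 0 else 1)"
      using not_both by auto
    then show ?case using Suc by simp
  qed
  moreover have "(1 / 2 :: rat) \<notin> \<int>"
  proof
    assume "(1 / 2 :: rat) \<in> \<int>"
    then obtain k :: int where "(1 / 2 :: rat) = of_int k" by (rule Ints_cases)
    then have "of_int (2 * k) = (1 :: rat)" by simp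
    then have "2 * k = 1" by (simp only: of_int_eq_1_iff)
    then show False by presburger
  qed
  ultimately show ?thesis
    using Ints_diff[of "height X n \<Lambda> r" "height X n \<Lambda> r - 1 / 2"]
    by (cases "?l dvd r") auto
qed

lemma proper_young_walls_eq:
  assumes "admissible_rank X n" "\<Lambda> \<in> level_one_weights X n"
  shows "proper_young_walls X n \<Lambda> =
    {Y. finite {k. Y k \<noteq> 0} \<and> antimono Y \<and>
        (\<forall>r\<in>#column_parts Y. delta_height X n dvd r \<or> count (column_parts Y) r = 1)}"
proof -
  have col: "column_height X n \<Lambda> Y k = height X n \<Lambda> (Y k)" for Y k
    by (simp add: column_height_def height_def)
  have le: "height X n \<Lambda> a \<le> height X n \<Lambda> b \<longleftrightarrow> a \<le> b" for a b
    using strict_mono_less_eq[OF strict_mono_height] .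
  have eq: "height X n \<Lambda> a = height X n \<Lambda> b \<longleftrightarrow> a = b" for a b
    using strict_mono_eq[OF strict_mono_height] .
  have l: "delta_height X n > 0" by (cases X) (auto simp: delta_height_def)
  have anti: "antimono (column_height X n \<Lambda> Y) \<longleftrightarrow> antimono Y" for Y
    by (simp add: monotone_on_def col le)
  show ?thesis
    unfolding proper_young_walls_def young_wall_def full_column_def anti
    by (simp only: col eq height_in_Ints_iff[OF assms] conj_assoc
        column_parts_distinct_iff[OF _ l] cong: conj_cong)
qed


section \<open>Weights\<close>

text \<open>The scaling element isolates the coefficient of \<open>\<alpha>\<^sub>0\<close>. As the Cartan matrix is tridiagonal with
  nonzero entries next to the diagonal, its row \<open>i\<close> then forces the coefficient of \<open>\<alpha>\<close> with index
  \<open>i + 1\<close> to vanish once all earlier ones do.\<close>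

lemma simple_roots_independent:
  fixes x :: "nat \<Rightarrow> int"
  assumes "\<And>h. (\<Sum>i\<le>n. x i * simple_root X n i h) = 0" and "i \<le> n"
  shows "x i = 0"
proof -
  have "(\<Sum>i\<le>n. x i * simple_root X n i Scaling) = (\<Sum>i\<le>n. if i = 0 then x i else 0)"
    by (intro sum.cong) (auto simp: simple_root_def)
  also have "\<dots> = x 0" by simp
  finally have "(\<Sum>i\<le>n. x i * simple_root X n i Scaling) = x 0" .
  then have x0: "x 0 = 0" using assms(1) by simp
  have "\<forall>j\<le>i. x j = 0" using assms(2)
  proof (induction i)
    case 0
    then show ?case using x0 by simp
  next
    case (Suc i)
    then have low: "\<forall>j\<le>i. x j = 0" and i: "Suc i \<le> n" by simp_all
    have "0 = (\<Sum>j\<le>n. x j * cartan X n i j)"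
      using assms(1)[of "Coroot i"] i by (simp add: simple_root_def)
    also have "\<dots> = (\<Sum>j\<in>{Suc i}. x j * cartan X n i j)"
    proof (rule sum.mono_neutral_right)
      show "\<forall>j\<in>{..n} - {Suc i}. x j * cartan X n i j = 0"
      proof
        fix j assume j: "j \<in> {..n} - {Suc i}"
        show "x j * cartan X n i j = 0"
        proof (cases "j \<le> i")
          case False
          then have "cartan X n i j = 0" using j by (auto simp: cartan_def)
          then show ?thesis by simp
        qed (use low in simp)
      qed
    qed (use i in auto)
    finally have "x (Suc i) * cartan X n i (Suc i) = 0" by simp
    moreover have "cartan X n i (Suc i) \<noteq> 0"
      by (auto simp: cartan_def split: affine_type.splits)
    ultimately have "x (Suc i) = 0" by simp
    then show ?case using low by (auto simp: le_Suc_eq)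
  qed
  then show ?thesis by blast
qed

lemma wall_weight_eq_iff:
  "wall_weight X n \<Lambda> Y = (\<lambda>h. \<Lambda> h - int m * null_root X n h) \<longleftrightarrow>
     (\<forall>i\<le>n. num_blocks X n \<Lambda> Y i = m * mark X n i)"
proof -
  define x where "x i = int (num_blocks X n \<Lambda> Y i) - int (m * mark X n i)" for i
  have null: "int m * null_root X n h = (\<Sum>i\<le>n. int (m * mark X n i) * simple_root X n i h)" for h
    unfolding null_root_def sum_distrib_left
    by (intro sum.cong) (auto simp: mark_def split: affine_type.splits)
  have "wall_weight X n \<Lambda> Y = (\<lambda>h. \<Lambda> h - int m * null_root X n h) \<longleftrightarrow>
      (\<forall>h. (\<Sum>i\<le>n. x i * simple_root X n i h) = 0)"
    unfolding wall_weight_def fun_eq_iff null x_def by (simp add: left_diff_distrib sum_subtractf)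
  also have "\<dots> \<longleftrightarrow> (\<forall>i\<le>n. x i = 0)"
    using simple_roots_independent[where x = x and n = n and X = X] by (auto intro!: sum.neutral)
  also have "\<dots> \<longleftrightarrow> (\<forall>i\<le>n. num_blocks X n \<Lambda> Y i = m * mark X n i)"
    unfolding x_def by (simp only: right_minus_eq of_nat_eq_iff)
  finally show ?thesis .
qed


section \<open>The string function\<close>

lemma card_walls_of_weight:
  assumes "admissible_rank X n" "\<Lambda> \<in> level_one_weights X n"
  shows "card (walls_of_weight X n \<Lambda> (\<lambda>h. \<Lambda> h - int m * null_root X n h)) =
    card {M \<in> wall_period.layer (delta_height X n) (period X n) n.
            sum_mset M div delta_height X n = m}"
proof -
  interpret wall_period "eps X" n "delta_height X n" "period X n"
    by (rule wall_period_admissible) fact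
  let ?W = "walls_of_weight X n \<Lambda> (\<lambda>h. \<Lambda> h - int m * null_root X n h)"
  let ?T = "{M \<in> layer n. sum_mset M div delta_height X n = m}"
  let ?S = "{Y :: wall. finite {k. Y k \<noteq> 0} \<and> antimono Y}"
  have S: "column_parts ` ?S = {M. 0 \<notin># M}"
    by (rule bij_betw_imp_surj_on[OF column_parts_bij])
  have W: "Y \<in> ?W \<longleftrightarrow> Y \<in> ?S \<and> column_parts Y \<in> ?T" for Y
  proof (cases "Y \<in> ?S")
    case True
    then have fin: "finite {k. Y k \<noteq> 0}" by simp
    have "0 \<notin># column_parts Y" using imageI[OF True, of column_parts] unfolding S by simp
    then show ?thesis
      using True layer_n_iff[of "column_parts Y" m] num_blocks_null_iff[OF assms fin, of m]
      unfolding walls_of_weight_def proper_young_walls_eq[OF assms] wall_weight_eq_iff by auto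
  next
    case False
    then show ?thesis unfolding walls_of_weight_def proper_young_walls_eq[OF assms] by auto
  qed
  have img: "column_parts ` ?W = ?T"
  proof (intro equalityI subsetI)
    fix M assume M: "M \<in> ?T"
    then have "M \<in> column_parts ` ?S" unfolding S by (simp add: layer_def)
    then obtain Y where Y: "M = column_parts Y" "Y \<in> ?S" by (rule imageE)
    then have "Y \<in> ?W" using M by (simp only: W simp_thms)
    with Y(1) show "M \<in> column_parts ` ?W" by (rule image_eqI)
  next
    fix M assume "M \<in> column_parts ` ?W"
    then obtain Y where "M = column_parts Y" "Y \<in> ?W" by (rule imageE)
    then show "M \<in> ?T" by (simp only: W)
  qed
  have inj: "inj_on column_parts ?W"
    by (intro inj_on_subset[OF bij_betw_imp_inj_on[OF column_parts_bij]] subsetI) (simp only: W)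
  show ?thesis using card_image[OF inj] unfolding img by (rule sym)
qed

theorem corollary4p7:
  fixes X :: affine_type and n :: nat and \<Lambda> :: weight
  assumes "admissible_rank X n"
    and "\<Lambda> \<in> level_one_weights X n"
  shows "string_function X n \<Lambda> \<Lambda> = 1 / (qpoch_inf 1 * qpoch_inf (eps X) ^ n)"
proof -
  interpret wall_period "eps X" n "delta_height X n" "period X n"
    by (rule wall_period_admissible) fact
  let ?Q = "qpoch_inf 1 * qpoch_inf (eps X) ^ n"
  have "string_function X n \<Lambda> \<Lambda> = gf (layer n) (\<lambda>M. sum_mset M div delta_height X n)"
    by (simp add: string_function_def gf_def card_walls_of_weight[OF assms])
  then have prod: "string_function X n \<Lambda> \<Lambda> * ?Q = 1"
    using layer_gf[of n] by simp
  then have "?Q \<noteq> 0" by (metis mult_zero_right zero_neq_one)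
  have "1 / ?Q = string_function X n \<Lambda> \<Lambda> * ?Q / ?Q" by (simp only: prod)
  also have "\<dots> = string_function X n \<Lambda> \<Lambda>"
    using \<open>?Q \<noteq> 0\<close> by (rule nonzero_mult_div_cancel_right)
  finally show ?thesis by simp
qed

end
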